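(* Let $p$ be a prime with $p>3$. Then $$\sum_{k=0}^{p-1}\binom{2k}k\frac{W_k}{54^k}\equiv\begin{cases} \left(\frac p3\right)(4x^2-2p)\pmod p&\text{if } p\equiv 1\pmod 4 \text{ and so } p=x^2+4y^2 \text{ with } x,y\in\mathbb Z,\\ 0\pmod p&\text{if } p\equiv 3\pmod 4.\end{cases}$$
   Context: For each nonnegative integer $n$, $W_n=\sum_{k=0}^{[n/3]}\binom{2k}k\binom{3k}k\binom n{3k}(-3)^{n-3k}$, where $[x]$ is the greatest integer not exceeding $x$. $\left(\frac p3\right)$ denotes the Legendre symbol. Congruences modulo $p$ between rational numbers are taken in the ring of rational numbers whose denominator is not divisible by $p$. *)

theory Defs
  imports Complex_Main "HOL-Number_Theory.Number_Theory"
begin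

definition W :: "nat \<Rightarrow> int" where
  "W n = (\<Sum>k=0..n div 3. int ((2 * k) choose k) * int ((3 * k) choose k)
            * int (n choose (3 * k)) * (-3) ^ (n - 3 * k))"

text \<open>The ring of rationals whose denominator (in lowest terms) is not divisible by \<open>p\<close>.\<close>

definition p_integral :: "nat \<Rightarrow> rat set" where
  "p_integral p = {r. \<not> int p dvd snd (quotient_of r)}"

text \<open>Congruence modulo the ideal generated by \<open>p\<close> in that ring. The library's
  \<open>cong\<close> at type \<^typ>\<open>rat\<close> is of no use here, since \<open>p\<close> is a unit of the field.
  Membership of both sides in the ring is part of the definition.\<close>

definition rat_cong :: "rat \<Rightarrow> rat \<Rightarrow> nat \<Rightarrow> bool" where
  "rat_cong a b p \<longleftrightarrow> a \<in> p_integral p \<and> b \<in> p_integral p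
     \<and> (\<exists>c\<in>p_integral p. a - b = of_nat p * c)"

end

theory Submission
  imports Defs "HOL-Computational_Algebra.Polynomial"
begin

text \<open>Put \<open>m = (p - 1) / 2\<close>. Since \<open>binom(2n, n)\<close> is congruent to \<open>binom(m, n) (-4)^n\<close>, the binomial
  theorem turns \<open>27^m S\<close> into the sum of \<open>m! / (k!^3 (m - 3k)!) (-8)^k 33^(m - 3k)\<close>. By a version of
  Clausen's identity modulo \<open>p\<close> this is the square of the Hasse invariant of
  \<open>y^2 = x^3 - 99 x + 378\<close>: as a function of the constant coefficient, the Hasse invariant satisfies a
  Legendre equation modulo \<open>p\<close>, and the symmetric square of that equation has the sum above as its
  only solution that is regular at the singular point. The curve has complex multiplication by
  \<open>Z[2i]\<close> and is 2-isogenous to \<open>y^2 = x^3 - x\<close>, whose character sum is evaluated by Jacobsthal's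
  argument.\<close>

section \<open>Legendre symbols and sums over residues\<close>

text \<open>The constants come from the general form of the identity: with w and d in place of 33
  and -8 the sum belongs to y^2 = x^3 - 3 w x + 2 v, where v^2 - w^3 = 27 d, and 189^2 - 33^3 = 27 *
  (-8). The j-invariant 1728 w^3 / (w^3 - v^2) is then 66^3, the value attached to Z[2i]. Modulo p
  the term 2p disappears, so only the square of a character sum has to be compared with 4 x^2; the
  signs of the Hasse invariant and of x never have to be determined. The symbol (p/3) has a separate
  origin: 27^m is congruent to the Legendre symbol of 27, hence of 3, modulo p. Clausen's identity
  compares power series over a field of characteristic 0. Modulo p the recurrences determine
  coefficients only up to index p - 1, so they are stated without division, units are cancelled at
  the end, and the degree of the polynomial involved has to stay below p.\<close>

locale prime_gt3 =
  fixes p :: nat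
  assumes prime_p: "prime p" and p_gt3: "p > 3"
begin

definition m :: nat where "m = (p - 1) div 2"

definition chi :: "int \<Rightarrow> int" where "chi a = Legendre a (int p)"

definition periodic :: "(int \<Rightarrow> int) \<Rightarrow> bool" where
  "periodic g \<longleftrightarrow> (\<forall>x y. [x = y] (mod int p) \<longrightarrow> g x = g y)"

definition rsum :: "(int \<Rightarrow> int) \<Rightarrow> int" where
  "rsum g = (\<Sum>x\<in>{0..<int p}. g x)"

lemma odd_p: "odd p"
  using prime_p p_gt3 prime_odd_nat by force

lemma p_eq: "p = 2 * m + 1"
  using odd_p unfolding m_def by (auto elim!: oddE)

lemma m_ge2: "m \<ge> 2"
  using p_eq p_gt3 by linarith

lemma prime_int_p: "prime (int p)"
  using prime_p by simp

lemma p_dvd_mult_iff: "int p dvd a * b \<longleftrightarrow> int p dvd a \<or> int p dvd b"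
  by (rule prime_dvd_mult_iff) (rule prime_int_p)

lemma p_dvd_power_iff: "n > 0 \<Longrightarrow> int p dvd a ^ n \<longleftrightarrow> int p dvd a"
  by (rule prime_dvd_power_iff) (rule prime_int_p)

lemma cong_mult_cancel:
  assumes "\<not> int p dvd k" "[k * a = k * b] (mod int p)"
  shows "[a = b] (mod int p)"
proof -
  have "int p dvd k * (a - b)" using assms(2) by (simp add: cong_iff_dvd_diff algebra_simps)
  thus ?thesis using assms(1) p_dvd_mult_iff cong_iff_dvd_diff by blast
qed

lemma not_dvd_pos: "0 < k \<Longrightarrow> k < int p \<Longrightarrow> \<not> int p dvd k"
  by (simp add: zdvd_not_zless)

lemma not_dvd_small: "0 < k \<Longrightarrow> k < p \<Longrightarrow> \<not> int p dvd int k"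
  by (rule not_dvd_pos) auto

lemma not_dvd_2: "\<not> int p dvd 2" and not_dvd_3: "\<not> int p dvd 3"
  using not_dvd_pos[of 2] not_dvd_pos[of 3] p_gt3 by auto

lemma inverse_exists:
  assumes "\<not> int p dvd a" obtains b where "[a * b = 1] (mod int p)" "\<not> int p dvd b"
proof -
  have "coprime (int p) a" using assms prime_imp_coprime prime_int_p by blast
  then obtain b where b: "[a * b = 1] (mod int p)"
    using cong_solve_coprime_int coprime_commute by blast
  have "\<not> int p dvd b"
  proof
    assume "int p dvd b"
    hence "int p dvd a * b" by simp
    hence "int p dvd 1" using b cong_dvd_iff by blast
    thus False using p_gt3 by simp
  qed
  thus ?thesis using b that by blast
qed

lemma fermat: assumes "\<not> int p dvd a" shows "[a ^ (p - 1) = 1] (mod int p)"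
proof -
  obtain c where c: "[a = int c] (mod int p)"
  proof
    show "[a = int (nat (a mod int p))] (mod int p)" using p_gt3 by (simp add: cong_def)
  qed
  have "\<not> p dvd c" using assms c cong_dvd_iff int_dvd_int_iff by blast
  hence "[c ^ (p - 1) = 1] (mod p)" using fermat_theorem prime_p by blast
  hence "[int c ^ (p - 1) = 1] (mod int p)"
    by (metis cong_int_iff of_nat_1 of_nat_power)
  with cong_pow[OF c, of "p - 1"] show ?thesis by (rule cong_trans)
qed

lemma chi_euler: "[chi a = a ^ m] (mod int p)"
  unfolding chi_def m_def using euler_criterion prime_p p_gt3 by simp

lemma chi_range: "chi a = -1 \<or> chi a = 0 \<or> chi a = 1"
  by (auto simp: chi_def Legendre_def)

lemma chi_cong: "[a = b] (mod int p) \<Longrightarrow> chi a = chi b"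
  unfolding chi_def Legendre_def QuadRes_def
  by (simp add: cong_def)

text \<open>Two integers in [-1, 1] differ by at most 2, and p > 3. This lifts congruences between
  Legendre symbols, obtained from Euler's criterion, to equalities.\<close>

lemma small_cong_eq:
  fixes x y :: int
  assumes "[x = y] (mod int p)" "\<bar>x\<bar> \<le> 1" "\<bar>y\<bar> \<le> 1"
  shows "x = y"
proof (rule ccontr)
  assume "x \<noteq> y"
  have "int p dvd x - y" using assms by (simp add: cong_iff_dvd_diff)
  hence "int p \<le> \<bar>x - y\<bar>" using \<open>x \<noteq> y\<close> dvd_imp_le_int[of "x - y" "int p"] by simp
  thus False using assms p_gt3 by linarith
qed

lemma abs_chi_le: "\<bar>chi a\<bar> \<le> 1"
  using chi_range[of a] by auto

lemma chi_mult: "chi (a * b) = chi a * chi b"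
proof (rule small_cong_eq)
  show "[chi (a * b) = chi a * chi b] (mod int p)"
    using cong_trans[OF chi_euler[of "a * b"], of "chi a * chi b"]
      cong_sym[OF cong_mult[OF chi_euler chi_euler], of a b]
    by (simp add: power_mult_distrib)
  show "\<bar>chi a * chi b\<bar> \<le> 1"
    using chi_range[of a] chi_range[of b] by auto
qed (rule abs_chi_le)

lemma chi_eq_0_iff: "chi a = 0 \<longleftrightarrow> int p dvd a"
  by (auto simp: chi_def Legendre_def cong_0_iff)

lemma chi_square: "\<not> int p dvd a \<Longrightarrow> chi a * chi a = 1"
  using chi_range[of a] chi_eq_0_iff[of a] by auto

lemma chi_power2: "chi (a\<^sup>2) = (if int p dvd a then 0 else 1)"
  using chi_square[of a] chi_eq_0_iff[of a] by (simp add: power2_eq_square chi_mult)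

lemma chi_0 [simp]: "chi 0 = 0" and chi_1 [simp]: "chi 1 = 1"
  using chi_eq_0_iff[of 0] chi_power2[of 1] p_gt3 by auto

lemma chi_minus: "chi (- a) = (-1) ^ m * chi a"
proof -
  have "chi (-1) = (-1) ^ m"
    by (rule small_cong_eq[OF chi_euler abs_chi_le]) (simp add: power_abs)
  thus ?thesis using chi_mult[of "-1" a] by simp
qed

lemma periodicD: "periodic g \<Longrightarrow> [x = y] (mod int p) \<Longrightarrow> g x = g y"
  unfolding periodic_def by blast

lemma periodic_mod: "periodic g \<Longrightarrow> g (x mod int p) = g x"
  by (erule periodicD) (simp add: cong_def)

lemma periodic_comp_chi:
  assumes "\<And>x y. [x = y] (mod int p) \<Longrightarrow> [f x = f y] (mod int p)"
  shows "periodic (\<lambda>x. chi (f x))"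
  using assms chi_cong unfolding periodic_def by blast

lemma rsum_reindex:
  assumes "periodic g"
    and "\<And>x y. [h x = h y] (mod int p) \<Longrightarrow> [x = y] (mod int p)"
  shows "rsum (\<lambda>x. g (h x)) = rsum g"
proof -
  let ?R = "{0..<int p}"
  have inj: "inj_on (\<lambda>x. h x mod int p) ?R"
  proof (rule inj_onI)
    fix x y assume xy: "x \<in> ?R" "y \<in> ?R" "h x mod int p = h y mod int p"
    have "[x = y] (mod int p)" by (rule assms(2)) (use xy(3) in \<open>simp add: cong_def\<close>)
    thus "x = y" using xy by (simp add: cong_def)
  qed
  have sub: "(\<lambda>x. h x mod int p) ` ?R \<subseteq> ?R" using p_gt3 by auto
  have "(\<lambda>x. h x mod int p) ` ?R = ?R"
    by (rule endo_inj_surj[OF _ sub inj]) simp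
  hence bij: "bij_betw (\<lambda>x. h x mod int p) ?R ?R" using inj by (simp add: bij_betw_def)
  have "rsum g = (\<Sum>x\<in>?R. g (h x mod int p))"
    unfolding rsum_def by (rule sum.reindex_bij_betw[OF bij, symmetric])
  also have "\<dots> = rsum (\<lambda>x. g (h x))"
    unfolding rsum_def
    by (intro sum.cong refl) (simp add: periodic_mod[OF assms(1)])
  finally show ?thesis by simp
qed

lemma rsum_shift: "periodic g \<Longrightarrow> rsum (\<lambda>x. g (x + c)) = rsum g"
  by (rule rsum_reindex) (simp_all add: cong_add_rcancel)

lemma rsum_scale: "periodic g \<Longrightarrow> \<not> int p dvd c \<Longrightarrow> rsum (\<lambda>x. g (c * x)) = rsum g"
  by (rule rsum_reindex) (simp_all add: cong_mult_cancel)

lemma rsum_minus: "periodic g \<Longrightarrow> rsum (\<lambda>x. g (- x)) = rsum g"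
  by (rule rsum_reindex) (simp_all add: cong_minus_minus_iff)

text \<open>Serves for substitutions that are not bijective, namely squaring and y = r l^2.\<close>

lemma rsum_fiber:
  assumes "periodic g"
  shows "rsum (\<lambda>x. g (h x)) =
    rsum (\<lambda>y. g y * int (card {x \<in> {0..<int p}. [h x = y] (mod int p)}))"
proof -
  let ?R = "{0..<int p}"
  have "rsum (\<lambda>x. g (h x)) = (\<Sum>x\<in>?R. g (h x mod int p))"
    unfolding rsum_def
    by (intro sum.cong refl) (simp add: periodic_mod[OF assms(1)])
  also have "\<dots> = (\<Sum>y\<in>?R. \<Sum>x | x \<in> ?R \<and> h x mod int p = y. g (h x mod int p))"
    by (rule sum.group[symmetric]) (use p_gt3 in auto)
  also have "\<dots> = (\<Sum>y\<in>?R. g y * int (card {x \<in> ?R. [h x = y] (mod int p)}))"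
  proof (intro sum.cong refl)
    fix y assume y: "y \<in> ?R"
    have "{x \<in> ?R. [h x = y] (mod int p)} = {x \<in> ?R. h x mod int p = y}"
      using y by (auto simp: cong_def)
    thus "(\<Sum>x | x \<in> ?R \<and> h x mod int p = y. g (h x mod int p))
        = g y * int (card {x \<in> ?R. [h x = y] (mod int p)})" by simp
  qed
  finally show ?thesis by (simp add: rsum_def)
qed

lemma card_square_roots: "int (card {z \<in> {0..<int p}. [z\<^sup>2 = a] (mod int p)}) = 1 + chi a"
proof -
  let ?Z = "{z \<in> {0..<int p}. [z\<^sup>2 = a] (mod int p)}"
  show ?thesis
  proof (cases "?Z = {}")
    case True
    have "\<not> QuadRes (int p) a"
    proof
      assume "QuadRes (int p) a"
      then obtain z where z: "[z\<^sup>2 = a] (mod int p)" by (auto simp: QuadRes_def)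
      have "z mod int p \<in> ?Z"
        using z p_gt3 by (simp add: cong_def power_mod)
      thus False using True by blast
    qed
    moreover have "\<not> [a = 0] (mod int p)"
    proof
      assume "[a = 0] (mod int p)"
      hence "0 \<in> ?Z" using p_gt3 by (simp add: cong_sym_eq)
      thus False using True by blast
    qed
    ultimately have "chi a = -1" by (simp add: chi_def Legendre_def)
    thus ?thesis unfolding True by simp
  next
    case False
    then obtain z where z: "z \<in> {0..<int p}" "[z\<^sup>2 = a] (mod int p)" by blast
    have chi: "chi a = (if int p dvd z then 0 else 1)"
      using chi_cong[OF z(2)] chi_power2 by simp
    have eq: "?Z = {z, (- z) mod int p}"
    proof (intro subset_antisym subsetI)
      fix y assume y: "y \<in> ?Z"
      hence "[y\<^sup>2 = z\<^sup>2] (mod int p)" using z(2) cong_sym cong_trans by blast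
      hence "int p dvd (y - z) * (y + z)"
        by (simp add: cong_iff_dvd_diff power2_eq_square algebra_simps)
      hence "[y = z] (mod int p) \<or> [y = - z] (mod int p)"
        by (simp add: p_dvd_mult_iff cong_iff_dvd_diff)
      thus "y \<in> {z, (- z) mod int p}" using y z by (auto simp: cong_def)
    next
      fix y assume "y \<in> {z, (- z) mod int p}"
      thus "y \<in> ?Z" using z p_gt3 by (auto simp: cong_def power_mod)
    qed
    show ?thesis
    proof (cases "int p dvd z")
      case True
      hence "z = 0" using z(1) zdvd_imp_le[of "int p" z] by force
      thus ?thesis using eq chi True by simp
    next
      case ndvd: False
      have "z \<noteq> (- z) mod int p"
      proof
        assume "z = (- z) mod int p"
        hence "[z = - z] (mod int p)" by (metis cong_mod_right cong_refl)
        hence "int p dvd 2 * z" by (simp add: cong_iff_dvd_diff)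
        thus False using ndvd not_dvd_2 p_dvd_mult_iff by blast
      qed
      thus ?thesis using eq chi ndvd by simp
    qed
  qed
qed

text \<open>Sorting all residues by their squares gives p = p + \<open>rsum chi\<close>.\<close>

lemma rsum_chi: "rsum chi = 0"
proof -
  have "periodic (\<lambda>_. 1)" by (simp add: periodic_def)
  from rsum_fiber[OF this, of "\<lambda>x. x\<^sup>2"]
  have "rsum (\<lambda>_. 1) = rsum (\<lambda>y. 1 + chi y)" by (simp only: card_square_roots mult_1)
  thus ?thesis by (simp add: rsum_def sum.distrib)
qed

text \<open>After a shift the argument is k (k + c) with c = b - a. If c is a unit and k is nonzero,
  this is k^2 (1 + c/k), and 1 + c/k runs over all residues except 1.\<close>

lemma rsum_chi_mult_shift:
  "rsum (\<lambda>k. chi ((k + a) * (k + b))) = (if [a = b] (mod int p) then int p - 1 else -1)"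
proof -
  have per: "periodic (\<lambda>k. chi (k * (k + c)))" for c
    by (intro periodic_comp_chi cong_mult cong_add cong_refl)
  have "rsum (\<lambda>k. chi ((k + a) * (k + b))) = rsum (\<lambda>k. chi (k * (k + (b - a))))"
    using rsum_shift[OF per[of "b - a"], of a] by (simp add: algebra_simps)
  also have "\<dots> = (if [a = b] (mod int p) then int p - 1 else -1)"
  proof (cases "[a = b] (mod int p)")
    case True
    have "chi (k * (k + (b - a))) = (if k = 0 then 0 else 1)" if "k \<in> {0..<int p}" for k
    proof -
      have "[k * (k + (b - a)) = k\<^sup>2] (mod int p)"
      proof -
        have "[k * (k + (b - a)) = k * (k + (a - a))] (mod int p)"
          using True by (intro cong_mult cong_add cong_diff cong_refl) (rule cong_sym)
        thus ?thesis by (simp add: power2_eq_square)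
      qed
      hence "chi (k * (k + (b - a))) = chi (k\<^sup>2)" by (rule chi_cong)
      thus ?thesis using that by (auto simp: chi_power2 zdvd_not_zless)
    qed
    hence "rsum (\<lambda>k. chi (k * (k + (b - a)))) = (\<Sum>k\<in>{0..<int p}. if k = 0 then 0 else 1)"
      unfolding rsum_def by (intro sum.cong) auto
    also have "\<dots> = (\<Sum>k\<in>{0..<int p} - {0}. 1)"
      by (rule sum.mono_neutral_cong_right) auto
    also have "\<dots> = int p - 1" using p_gt3 by (simp add: card_Diff_singleton)
    finally show ?thesis using True by simp
  next
    case False
    define c where "c = b - a"
    have c: "\<not> int p dvd c"
      using False unfolding c_def by (simp add: cong_iff_dvd_diff dvd_diff_commute)
    \<comment> \<open>\<open>h\<close> is the map 1 + c/k, with the missing value 1 assigned at 0;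
      this makes it a permutation, and the surplus term \<open>chi 1\<close> is subtracted
      below.\<close>
    define h where "h = (\<lambda>k. if int p dvd k then 1 else c * (SOME i. [k * i = 1] (mod int p)) + 1)"
    have h: "[k * (h k - 1) = c] (mod int p)" if "\<not> int p dvd k" for k
    proof -
      have "[k * (SOME i. [k * i = 1] (mod int p)) = 1] (mod int p)"
        by (rule someI_ex) (use inverse_exists[OF that] in blast)
      from cong_scalar_left[OF this, of c] show ?thesis
        using that by (simp add: h_def mult_ac)
    qed
    have inj: "[x = y] (mod int p)" if hxy: "[h x = h y] (mod int p)" for x y
    proof -
      have zero: "int p dvd u" if "[h u = 1] (mod int p)" for u
      proof (rule ccontr)
        assume u: "\<not> int p dvd u"
        have "int p dvd u * (h u - 1)" using that by (simp add: cong_iff_dvd_diff)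
        hence "int p dvd c" using cong_dvd_iff[OF h[OF u]] by simp
        thus False using c by blast
      qed
      show ?thesis
      proof (cases "int p dvd x \<or> int p dvd y")
        case True
        hence "h x = 1 \<or> h y = 1" by (auto simp: h_def)
        hence "int p dvd x \<and> int p dvd y"
        proof
          assume "h x = 1"
          thus ?thesis using zero[of x] zero[of y] cong_sym[OF hxy] by simp
        next
          assume "h y = 1"
          thus ?thesis using zero[of x] zero[of y] hxy by simp
        qed
        thus ?thesis by (simp add: cong_iff_dvd_diff)
      next
        case nz: False
        have "[y * (h x - 1) = y * (h y - 1)] (mod int p)"
          using hxy by (intro cong_mult cong_diff cong_refl)
        from cong_trans[OF this h[of y]] have "[y * (h x - 1) = c] (mod int p)" using nz by simp
        hence "[(h x - 1) * x = (h x - 1) * y] (mod int p)"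
          using h[of x] nz cong_trans[OF _ cong_sym, of "x * (h x - 1)" c] by (simp add: mult.commute)
        moreover have "\<not> int p dvd h x - 1"
          using zero[of x] nz by (auto simp: cong_iff_dvd_diff)
        ultimately show ?thesis by (rule cong_mult_cancel[rotated])
      qed
    qed
    have "chi (k * (k + c)) = chi (h k) - (if k = 0 then 1 else 0)" if "k \<in> {0..<int p}" for k
    proof (cases "k = 0")
      case True
      thus ?thesis by (simp add: h_def)
    next
      case False
      hence nk: "\<not> int p dvd k" using that by (simp add: zdvd_not_zless)
      have "k\<^sup>2 * h k = k * (k + k * (h k - 1))"
        by (simp add: power2_eq_square algebra_simps)
      also have "[k * (k + k * (h k - 1)) = k * (k + c)] (mod int p)"
        using h[OF nk] by (intro cong_mult cong_add cong_refl)
      finally have "chi (k\<^sup>2 * h k) = chi (k * (k + c))" by (rule chi_cong)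
      moreover have "chi (k\<^sup>2 * h k) = chi (h k)"
        using nk by (simp only: chi_mult chi_power2) simp
      ultimately show ?thesis using False by simp
    qed
    hence "rsum (\<lambda>k. chi (k * (k + c))) = rsum (\<lambda>k. chi (h k) - (if k = 0 then 1 else 0))"
      unfolding rsum_def by (intro sum.cong) auto
    also have "\<dots> = rsum (\<lambda>k. chi (h k)) - 1"
      using p_gt3 by (simp add: rsum_def sum_subtractf)
    also have "rsum (\<lambda>k. chi (h k)) = rsum chi"
      by (rule rsum_reindex[OF _ inj]) (use chi_cong in \<open>auto simp: periodic_def\<close>)
    finally show ?thesis using False by (simp add: rsum_chi c_def)
  qed
  finally show ?thesis .
qed

text \<open>Replacing x by g x for a primitive root g leaves the sum unchanged modulo p but
  multiplies it by g^j, which is not 1.\<close>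

lemma rsum_power:
  assumes "\<not> (p - 1) dvd j"
  shows "[rsum (\<lambda>x. x ^ j) = 0] (mod int p)"
proof -
  obtain g where g: "residue_primroot p g"
    using prime_primitive_root_exists[of p] prime_p prime_gt_1_nat by blast
  have "ord p g = p - 1"
    using g prime_p by (simp add: residue_primroot_def totient_prime)
  hence "\<not> [g ^ j = 1] (mod p)" using assms by (simp add: ord_divides')
  hence nc: "\<not> [int g ^ j = 1] (mod int p)"
    by (metis cong_int_iff of_nat_1 of_nat_power)
  have "coprime p g" using g by (simp add: residue_primroot_def)
  hence "\<not> p dvd g" using prime_p by (auto simp: coprime_absorb_left)
  hence ng: "\<not> int p dvd int g" by simp
  \<comment> \<open>Powers of congruent integers are congruent but not equal; reducing them modulo p
    makes the summand \<open>periodic\<close>.\<close>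
  have "periodic (\<lambda>x. x ^ j mod int p)"
    using cong_pow by (auto simp: periodic_def cong_def)
  from rsum_scale[OF this ng]
  have "rsum (\<lambda>x. (int g * x) ^ j mod int p) = rsum (\<lambda>x. x ^ j mod int p)" .
  moreover have "rsum f mod int p = rsum (\<lambda>x. f x mod int p) mod int p" for f
    unfolding rsum_def by (simp add: mod_sum_eq)
  ultimately have "[rsum (\<lambda>x. (int g * x) ^ j) = rsum (\<lambda>x. x ^ j)] (mod int p)"
    unfolding cong_def by metis
  moreover have "rsum (\<lambda>x. (int g * x) ^ j) = int g ^ j * rsum (\<lambda>x. x ^ j)"
    by (simp add: rsum_def sum_distrib_left power_mult_distrib)
  ultimately have "int p dvd (int g ^ j - 1) * rsum (\<lambda>x. x ^ j)"
    by (simp add: cong_iff_dvd_diff algebra_simps)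
  thus ?thesis using nc unfolding p_dvd_mult_iff cong_iff_dvd_diff by simp
qed

lemma rsum_power_p_minus_1: "[rsum (\<lambda>x. x ^ (p - 1)) = -1] (mod int p)"
proof -
  have "[x ^ (p - 1) = (if x = 0 then 0 else 1)] (mod int p)" if "x \<in> {0..<int p}" for x
    using that fermat[of x] p_gt3 by (auto simp: zdvd_not_zless power_0_left)
  hence "[rsum (\<lambda>x. x ^ (p - 1)) = (\<Sum>x\<in>{0..<int p}. if x = 0 then 0 else 1)] (mod int p)"
    unfolding rsum_def by (rule cong_sum)
  also have "(\<Sum>x\<in>{0..<int p}. if x = 0 then 0 else 1) = (\<Sum>k\<in>{0..<int p} - {0}. 1 :: int)"
    by (rule sum.mono_neutral_cong_right) auto
  also have "\<dots> = int p - 1" using p_gt3 by (simp add: card_Diff_singleton)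
  also have "[int p - 1 = -1] (mod int p)" by (simp add: cong_iff_dvd_diff)
  finally show ?thesis .
qed

end

section \<open>The curve $y^2 = x^3 - x$\<close>

text \<open>Brahmagupta's identities write q^2 = u^2 + v^2 with v = ad - bc or v = ad + bc. The
  product of these two v is q (a^2 - c^2), so q divides one of them, and for that one v = 0 or u =
  0. The case v = 0 gives a^2 = c^2; u = 0 would give q = a^2 + c^2, which is even.\<close>

lemma two_squares_unique:
  fixes a b c d q :: int
  assumes "prime q" "odd q" "odd a" "odd c" and ab: "q = a\<^sup>2 + b\<^sup>2" and cd: "q = c\<^sup>2 + d\<^sup>2"
  shows "a\<^sup>2 = c\<^sup>2"
proof -
  have q: "q > 0" using assms(1) prime_gt_0_int by blast
  have id1: "q\<^sup>2 = (a * c + b * d)\<^sup>2 + (a * d - b * c)\<^sup>2"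
    unfolding power2_eq_square[of q] by (subst (1) ab, subst cd) (simp add: power2_eq_square algebra_simps)
  have id2: "q\<^sup>2 = (a * c - b * d)\<^sup>2 + (a * d + b * c)\<^sup>2"
    unfolding power2_eq_square[of q] by (subst (1) ab, subst cd) (simp add: power2_eq_square algebra_simps)
  have key: "a\<^sup>2 = c\<^sup>2" if dvd: "q dvd v" and id: "q\<^sup>2 = u\<^sup>2 + v\<^sup>2"
      and uv: "(u = 0 \<longrightarrow> a\<^sup>2 * c\<^sup>2 = b\<^sup>2 * d\<^sup>2)" "(v = 0 \<longrightarrow> a\<^sup>2 * d\<^sup>2 = b\<^sup>2 * c\<^sup>2)" for u v
  proof (cases "v = 0")
    case True
    hence "a\<^sup>2 * d\<^sup>2 = b\<^sup>2 * c\<^sup>2" using uv by blast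
    hence "a\<^sup>2 * (c\<^sup>2 + d\<^sup>2) = c\<^sup>2 * (a\<^sup>2 + b\<^sup>2)" by (simp add: algebra_simps)
    hence "a\<^sup>2 * q = c\<^sup>2 * q" by (simp only: ab[symmetric] cd[symmetric])
    thus ?thesis using q by simp
  next
    case False
    have "q\<^sup>2 dvd v\<^sup>2" using dvd by simp
    hence "q\<^sup>2 \<le> v\<^sup>2" using False by (intro zdvd_imp_le) auto
    hence "u = 0" using id by (smt (verit) zero_less_power2)
    hence "a\<^sup>2 * c\<^sup>2 = (q - a\<^sup>2) * (q - c\<^sup>2)" using uv ab cd by simp
    hence "q * (q - a\<^sup>2 - c\<^sup>2) = 0" by (simp add: algebra_simps)
    hence "q = a\<^sup>2 + c\<^sup>2" using q by simp
    thus ?thesis using assms(2,3,4) by auto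
  qed
  have "q dvd (a * d - b * c) * (a * d + b * c)"
  proof -
    have "(a * d - b * c) * (a * d + b * c) = a\<^sup>2 * (c\<^sup>2 + d\<^sup>2) - c\<^sup>2 * (a\<^sup>2 + b\<^sup>2)"
      by (simp add: power2_eq_square algebra_simps)
    also have "\<dots> = q * (a\<^sup>2 - c\<^sup>2)" using ab cd by (simp add: algebra_simps)
    finally show ?thesis by simp
  qed
  hence "q dvd a * d - b * c \<or> q dvd a * d + b * c"
    using assms(1) prime_dvd_mult_iff by blast
  thus ?thesis
  proof
    assume "q dvd a * d - b * c"
    thus ?thesis
    proof (rule key[OF _ id1])
      show "a * c + b * d = 0 \<longrightarrow> a\<^sup>2 * c\<^sup>2 = b\<^sup>2 * d\<^sup>2"
        by (metis eq_neg_iff_add_eq_0 power2_minus power_mult_distrib)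
      show "a * d - b * c = 0 \<longrightarrow> a\<^sup>2 * d\<^sup>2 = b\<^sup>2 * c\<^sup>2"
        by (metis eq_iff_diff_eq_0 power_mult_distrib)
    qed
  next
    assume "q dvd a * d + b * c"
    thus ?thesis
    proof (rule key[OF _ id2])
      show "a * c - b * d = 0 \<longrightarrow> a\<^sup>2 * c\<^sup>2 = b\<^sup>2 * d\<^sup>2"
        by (metis eq_iff_diff_eq_0 power_mult_distrib)
      show "a * d + b * c = 0 \<longrightarrow> a\<^sup>2 * d\<^sup>2 = b\<^sup>2 * c\<^sup>2"
        by (metis eq_neg_iff_add_eq_0 power2_minus power_mult_distrib)
    qed
  qed
qed

context prime_gt3 begin

lemma rsum_cong: "(\<And>x. x \<in> {0..<int p} \<Longrightarrow> f x = g x) \<Longrightarrow> rsum f = rsum g"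
  unfolding rsum_def by (rule sum.cong) auto

lemma rsum_add: "rsum (\<lambda>x. f x + g x) = rsum f + rsum g"
  by (simp add: rsum_def sum.distrib)

lemma rsum_mult_left: "rsum (\<lambda>x. c * f x) = c * rsum f"
  by (simp add: rsum_def sum_distrib_left)

lemma rsum_swap: "rsum (\<lambda>x. rsum (f x)) = rsum (\<lambda>y. rsum (\<lambda>x. f x y))"
  unfolding rsum_def by (rule sum.swap)

lemma rsum_delta: "rsum (\<lambda>x. if x = 0 then 0 else c) = (int p - 1) * c"
proof -
  have "rsum (\<lambda>x. if x = 0 then 0 else c) = (\<Sum>x\<in>{0..<int p} - {0}. c)"
    unfolding rsum_def by (rule sum.mono_neutral_cong_right) auto
  thus ?thesis using p_gt3 by (simp add: card_Diff_singleton)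
qed

lemma card_eq_rsum: "int (card {x \<in> {0..<int p}. Q x}) = rsum (\<lambda>x. of_bool (Q x))"
  unfolding rsum_def by (simp add: of_bool_def sum.If_cases Int_def)

lemma not_dvd_residue: "x \<in> {0..<int p} \<Longrightarrow> x \<noteq> 0 \<Longrightarrow> \<not> int p dvd x"
  by (simp add: zdvd_not_zless)

lemma rsum_roots_mult:
  assumes "\<not> int p dvd r"
  shows "rsum (\<lambda>l. of_bool [r * l\<^sup>2 = y] (mod int p)) = 1 + chi r * chi y"
proof -
  obtain s where s: "[r * s = 1] (mod int p)" using inverse_exists[OF assms] by blast
  have iff: "[r * l\<^sup>2 = y] (mod int p) \<longleftrightarrow> [l\<^sup>2 = s * y] (mod int p)" for l
  proof -
    have "[r * (s * y) = y] (mod int p)"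
      using cong_scalar_right[OF s, of y] by (simp add: mult.assoc)
    hence "[r * l\<^sup>2 = y] (mod int p) \<longleftrightarrow> [r * l\<^sup>2 = r * (s * y)] (mod int p)"
      by (simp add: cong_def)
    also have "\<dots> \<longleftrightarrow> [l\<^sup>2 = s * y] (mod int p)"
      using cong_mult_cancel[OF assms] cong_scalar_left by blast
    finally show ?thesis .
  qed
  have "chi r * chi s = 1" using chi_cong[OF s] by (simp add: chi_mult)
  hence "chi s = chi r" using chi_range[of r] chi_range[of s] by auto
  moreover have "rsum (\<lambda>l. of_bool [r * l\<^sup>2 = y] (mod int p)) = 1 + chi (s * y)"
    unfolding iff card_square_roots[symmetric] card_eq_rsum ..
  ultimately show ?thesis by (simp add: chi_mult)
qed

text \<open>Each y is attained 1 + \<open>chi r * chi y\<close> times. Adding the formulas for a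
  residue r and a nonresidue r removes the second term.\<close>

lemma rsum_mult_square:
  assumes "periodic g" "\<not> int p dvd r"
  shows "rsum (\<lambda>l. g (r * l\<^sup>2)) = rsum g + chi r * rsum (\<lambda>y. g y * chi y)"
proof -
  have "rsum (\<lambda>l. g (r * l\<^sup>2)) = rsum (\<lambda>y. g y * (1 + chi r * chi y))"
    unfolding rsum_fiber[OF assms(1), of "\<lambda>l. r * l\<^sup>2"] card_eq_rsum rsum_roots_mult[OF assms(2)] ..
  also have "\<dots> = rsum (\<lambda>y. g y + chi r * (g y * chi y))"
    by (rule rsum_cong) (simp add: algebra_simps)
  finally show ?thesis by (simp only: rsum_add rsum_mult_left)
qed

section \<open>Jacobsthal sums\<close>

text \<open>For k prime to p this is minus the trace of Frobenius of y^2 = x^3 + k x.\<close>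

definition J :: "int \<Rightarrow> int" where
  "J k = rsum (\<lambda>x. chi (x * (x\<^sup>2 + k)))"

lemma periodic_J_summand: "periodic (\<lambda>x. chi (x * (x\<^sup>2 + k)))"
  by (intro periodic_comp_chi cong_mult cong_add cong_refl cong_pow)

lemma periodic_J: "periodic J"
  unfolding periodic_def J_def
  by (intro allI impI rsum_cong chi_cong cong_mult cong_add cong_refl)

text \<open>Substituting l x for x pulls out l^3, whose symbol is that of l. Hence, for k prime to
  p, the square of \<open>J k\<close> depends only on the quadratic character of k.\<close>

lemma J_mult_square:
  assumes "\<not> int p dvd l"
  shows "J (k * l\<^sup>2) = chi l * J k"
proof -
  have "J (k * l\<^sup>2) = rsum (\<lambda>x. chi ((l * x) * ((l * x)\<^sup>2 + k * l\<^sup>2)))"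
    unfolding J_def by (rule rsum_scale[OF periodic_J_summand assms, symmetric])
  also have "\<dots> = rsum (\<lambda>x. chi l * chi (x * (x\<^sup>2 + k)))"
  proof (rule rsum_cong)
    fix x
    have "(l * x) * ((l * x)\<^sup>2 + k * l\<^sup>2) = l\<^sup>2 * (l * (x * (x\<^sup>2 + k)))"
      by (simp add: power2_eq_square algebra_simps)
    thus "chi ((l * x) * ((l * x)\<^sup>2 + k * l\<^sup>2)) = chi l * chi (x * (x\<^sup>2 + k))"
      using assms by (simp only: chi_mult[of "l\<^sup>2"] chi_power2 chi_mult[of l]) simp
  qed
  finally show ?thesis by (simp only: rsum_mult_left J_def)
qed

lemma J_0: "J 0 = 0"
proof -
  have "J 0 = rsum chi" unfolding J_def
  proof (rule rsum_cong)
    fix x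
    have "chi (x * (x\<^sup>2 + 0)) = chi x * chi (x\<^sup>2)" by (simp add: chi_mult)
    thus "chi (x * (x\<^sup>2 + 0)) = chi x" by (simp add: chi_power2 chi_eq_0_iff)
  qed
  thus ?thesis by (simp add: rsum_chi)
qed

lemma J_odd: assumes "odd m" shows "J k = 0"
proof -
  have "J k = rsum (\<lambda>x. chi ((- x) * ((- x)\<^sup>2 + k)))"
    unfolding J_def by (rule rsum_minus[OF periodic_J_summand, symmetric])
  also have "\<dots> = rsum (\<lambda>x. (-1) * chi (x * (x\<^sup>2 + k)))"
    using assms by (intro rsum_cong) (simp add: chi_minus)
  also have "\<dots> = - J k" by (simp only: rsum_mult_left J_def)
  finally show ?thesis by simp
qed

text \<open>Expanding the square and summing over k before x and y leaves p
  \<open>chi (x * y)\<close> on the pairs with y^2 = x^2, and -\<open>chi x * chi y\<close> on all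
  pairs; the latter adds up to minus the square of \<open>rsum chi\<close>, which is 0. For even m
  the symbol of -1 is 1, so y = x and y = -x both count with sign +1.\<close>

lemma rsum_J_square:
  assumes "even m"
  shows "rsum (\<lambda>k. (J k)\<^sup>2) = 2 * int p * (int p - 1)"
proof -
  have inner: "rsum (\<lambda>k. chi (x * (x\<^sup>2 + k)) * chi (y * (y\<^sup>2 + k)))
      = int p * (chi (x * y) * of_bool [1 * y\<^sup>2 = x\<^sup>2] (mod int p)) - chi x * chi y" for x y
  proof -
    have "rsum (\<lambda>k. chi (x * (x\<^sup>2 + k)) * chi (y * (y\<^sup>2 + k)))
      = rsum (\<lambda>k. chi (x * y) * chi ((k + x\<^sup>2) * (k + y\<^sup>2)))"
      by (rule rsum_cong) (simp add: chi_mult add.commute mult_ac)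
    also have "\<dots> = chi (x * y) * (if [x\<^sup>2 = y\<^sup>2] (mod int p) then int p - 1 else -1)"
      by (simp only: rsum_mult_left rsum_chi_mult_shift)
    finally show ?thesis by (simp add: chi_mult cong_sym_eq algebra_simps)
  qed
  have diag: "rsum (\<lambda>y. chi (x * y) * of_bool [1 * y\<^sup>2 = x\<^sup>2] (mod int p)) = (if x = 0 then 0 else 2)"
    if x: "x \<in> {0..<int p}" for x
  proof (cases "x = 0")
    case True
    thus ?thesis by (simp add: rsum_def)
  next
    case False
    have eq: "chi (x * y) * of_bool [1 * y\<^sup>2 = x\<^sup>2] (mod int p) = of_bool [1 * y\<^sup>2 = x\<^sup>2] (mod int p)" for y
    proof (cases "[y\<^sup>2 = x\<^sup>2] (mod int p)")
      case True
      hence "int p dvd (y - x) * (y + x)"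
        by (simp add: cong_iff_dvd_diff power2_eq_square algebra_simps)
      hence "[y = x] (mod int p) \<or> [y = - x] (mod int p)"
        unfolding p_dvd_mult_iff by (simp add: cong_iff_dvd_diff)
      hence "chi y = chi x" using chi_cong[of y x] chi_cong[of y "-x"] chi_minus[of x] assms by auto
      hence "chi (x * y) = 1" using chi_square not_dvd_residue[OF x False] by (simp add: chi_mult)
      thus ?thesis by simp
    qed simp
    have "\<not> int p dvd 1" using p_gt3 by simp
    hence "rsum (\<lambda>y. chi (x * y) * of_bool [1 * y\<^sup>2 = x\<^sup>2] (mod int p))
      = 1 + chi 1 * chi (x\<^sup>2)"
      unfolding eq by (rule rsum_roots_mult)
    thus ?thesis using not_dvd_residue[OF x False] False by (simp add: chi_power2)
  qed
  have "rsum (\<lambda>k. (J k)\<^sup>2)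
      = rsum (\<lambda>k. rsum (\<lambda>x. rsum (\<lambda>y. chi (x * (x\<^sup>2 + k)) * chi (y * (y\<^sup>2 + k)))))"
    by (simp add: J_def power2_eq_square rsum_def sum_product)
  also have "\<dots> = rsum (\<lambda>x. rsum (\<lambda>k. rsum (\<lambda>y. chi (x * (x\<^sup>2 + k)) * chi (y * (y\<^sup>2 + k)))))"
    by (rule rsum_swap)
  also have "\<dots> = rsum (\<lambda>x. rsum (\<lambda>y. rsum (\<lambda>k. chi (x * (x\<^sup>2 + k)) * chi (y * (y\<^sup>2 + k)))))"
    by (rule rsum_cong) (rule rsum_swap)
  also have "\<dots> = rsum (\<lambda>x. int p * (if x = 0 then 0 else 2) + (- rsum chi) * chi x)"
  proof (rule rsum_cong)
    fix x assume x: "x \<in> {0..<int p}"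
    have "rsum (\<lambda>y. rsum (\<lambda>k. chi (x * (x\<^sup>2 + k)) * chi (y * (y\<^sup>2 + k))))
      = rsum (\<lambda>y. int p * (chi (x * y) * of_bool [1 * y\<^sup>2 = x\<^sup>2] (mod int p)) + (- chi x) * chi y)"
      unfolding inner by simp
    thus "rsum (\<lambda>y. rsum (\<lambda>k. chi (x * (x\<^sup>2 + k)) * chi (y * (y\<^sup>2 + k))))
      = int p * (if x = 0 then 0 else 2) + (- rsum chi) * chi x"
      by (simp only: rsum_add rsum_mult_left diag[OF x]) simp
  qed
  also have "\<dots> = int p * ((int p - 1) * 2)"
    by (simp add: rsum_add rsum_mult_left rsum_delta rsum_chi)
  finally show ?thesis by simp
qed

lemma nonresidue_exists: obtains n where "chi n = -1"
proof -
  have "\<exists>n. chi n = -1"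
  proof (rule ccontr)
    assume "\<nexists>n. chi n = -1"
    hence nonneg: "chi n \<ge> 0" for n using chi_range[of n] by auto
    have "(\<Sum>x\<in>{1}. chi x) \<le> rsum chi"
      unfolding rsum_def using p_gt3 nonneg by (intro sum_mono2) auto
    thus False by (simp add: rsum_chi)
  qed
  thus ?thesis using that by blast
qed

text \<open>The nonzero k split into (p - 1)/2 residues and (p - 1)/2 nonresidues. On each half the
  square of \<open>J\<close> is constant, with the value at -1 (a residue, since m is even) and at n
  respectively; \<open>rsum_J_square\<close> gives the total.\<close>

lemma J_square_sum:
  assumes "even m" "chi n = -1"
  shows "(J (-1))\<^sup>2 + (J n)\<^sup>2 = 4 * int p"
proof -
  have per: "periodic (\<lambda>k. (J k)\<^sup>2)"
    using periodicD[OF periodic_J] unfolding periodic_def by auto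
  have ev: "rsum (\<lambda>l. (J (r * l\<^sup>2))\<^sup>2) = (int p - 1) * (J r)\<^sup>2" for r
  proof -
    have "rsum (\<lambda>l. (J (r * l\<^sup>2))\<^sup>2) = rsum (\<lambda>l. if l = 0 then 0 else (J r)\<^sup>2)"
    proof (rule rsum_cong)
      fix l assume l: "l \<in> {0..<int p}"
      show "(J (r * l\<^sup>2))\<^sup>2 = (if l = 0 then 0 else (J r)\<^sup>2)"
      proof (cases "l = 0")
        case False
        hence "(J (r * l\<^sup>2))\<^sup>2 = (chi l)\<^sup>2 * (J r)\<^sup>2"
          using J_mult_square[OF not_dvd_residue[OF l]] by (simp add: power_mult_distrib)
        thus ?thesis using False chi_square[OF not_dvd_residue[OF l]] by (simp add: power2_eq_square)
      qed (simp add: J_0)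
    qed
    thus ?thesis by (simp only: rsum_delta)
  qed
  have n: "\<not> int p dvd n" using assms(2) chi_eq_0_iff[of n] by auto
  have c1: "chi (-1) = 1" using chi_minus[of 1] assms(1) by simp
  have "\<not> int p dvd -1" using p_gt3 by simp
  from rsum_mult_square[OF per this] rsum_mult_square[OF per n]
  have "(int p - 1) * (J (-1))\<^sup>2 + (int p - 1) * (J n)\<^sup>2 = 2 * rsum (\<lambda>k. (J k)\<^sup>2)"
    unfolding ev c1 assms(2) by linarith
  hence "(int p - 1) * ((J (-1))\<^sup>2 + (J n)\<^sup>2) = (int p - 1) * (4 * int p)"
    unfolding rsum_J_square[OF assms(1)] by (simp add: algebra_simps)
  thus ?thesis using p_gt3 by simp
qed

lemma J_eq_half_sum:
  assumes "even m"
  shows "J k = 2 * (\<Sum>x\<in>{1..int m}. chi (x * (x\<^sup>2 + k)))"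
proof -
  let ?f = "\<lambda>x. chi (x * (x\<^sup>2 + k))"
  have neg: "?f (int p - x) = ?f x" for x
  proof -
    have "[int p - x = - x] (mod int p)" by (simp add: cong_iff_dvd_diff)
    hence "?f (int p - x) = ?f (- x)" using periodicD[OF periodic_J_summand] by blast
    thus ?thesis using assms by (simp add: chi_minus)
  qed
  have set: "{0..<int p} = insert 0 ({1..int m} \<union> {int m + 1..2 * int m})"
    using p_eq by auto
  have "(\<Sum>x\<in>{int m + 1..2 * int m}. ?f x) = (\<Sum>x\<in>{1..int m}. ?f x)"
    by (rule sum.reindex_bij_witness[of _ "\<lambda>x. int p - x" "\<lambda>x. int p - x"]) (use p_eq neg in auto)
  moreover have "J k = (\<Sum>x\<in>{1..int m}. ?f x) + (\<Sum>x\<in>{int m + 1..2 * int m}. ?f x)"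
    unfolding J_def rsum_def set by (subst sum.insert, simp, simp, subst sum.union_disjoint) auto
  ultimately show ?thesis by simp
qed

text \<open>Exactly the term \<open>x = 1\<close> vanishes, which leaves an odd number of odd terms.\<close>

lemma half_J_odd:
  assumes "even m"
  shows "odd (\<Sum>x\<in>{1..int m}. chi (x * (x\<^sup>2 + (-1))))"
proof -
  have "odd (chi (x * (x\<^sup>2 + (-1))))" if x: "x \<in> {2..int m}" for x
  proof -
    have "\<not> int p dvd x * ((x - 1) * (x + 1))"
      unfolding p_dvd_mult_iff using x p_eq by (auto dest: zdvd_imp_le)
    hence "chi (x * (x\<^sup>2 + (-1))) \<noteq> 0"
      by (simp add: chi_eq_0_iff power2_eq_square algebra_simps)
    thus ?thesis using chi_range[of "x * (x\<^sup>2 + (-1))"] by auto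
  qed
  hence one: "chi (x * (x\<^sup>2 + (-1))) mod 2 = 1" if "x \<in> {2..int m}" for x
    using that odd_iff_mod_2_eq_one by blast
  have "(\<Sum>x\<in>{2..int m}. chi (x * (x\<^sup>2 + (-1)))) mod 2
      = (\<Sum>x\<in>{2..int m}. chi (x * (x\<^sup>2 + (-1))) mod 2) mod 2"
    by (rule mod_sum_eq[symmetric])
  also have "\<dots> = (\<Sum>x\<in>{2..int m}. 1) mod 2"
    by (rule arg_cong[where f = "\<lambda>s. s mod 2"], rule sum.cong[OF refl], rule one)
  also have "\<dots> = 1" using assms m_ge2 by (simp add: odd_iff_mod_2_eq_one[symmetric])
  finally have "odd (\<Sum>x\<in>{2..int m}. chi (x * (x\<^sup>2 + (-1))))"
    by (simp only: odd_iff_mod_2_eq_one)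
  moreover have "{1..int m} = insert 1 {2..int m}" using m_ge2 by auto
  ultimately show ?thesis using assms m_ge2 by simp
qed

text \<open>The halves a of \<open>J (-1)\<close> and b of \<open>J n\<close> satisfy p = a^2 + b^2.
  As a is odd, b is even, and uniqueness of the representation transfers the value to every given
  x.\<close>

lemma J_square:
  assumes "even m"
  shows "\<exists>x y. int p = x\<^sup>2 + 4 * y\<^sup>2"
    and "\<And>x y. int p = x\<^sup>2 + 4 * y\<^sup>2 \<Longrightarrow> (J (-1))\<^sup>2 = 4 * x\<^sup>2"
proof -
  obtain n where n: "chi n = -1" by (rule nonresidue_exists)
  define a where "a = (\<Sum>x\<in>{1..int m}. chi (x * (x\<^sup>2 + (-1))))"
  define b where "b = (\<Sum>x\<in>{1..int m}. chi (x * (x\<^sup>2 + n)))"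
  have J: "J (-1) = 2 * a" "J n = 2 * b" unfolding a_def b_def by (rule J_eq_half_sum[OF assms])+
  have ab: "int p = a\<^sup>2 + b\<^sup>2" using J_square_sum[OF assms n] unfolding J by (simp add: power_mult_distrib)
  have a: "odd a" unfolding a_def by (rule half_J_odd[OF assms])
  have odd: "odd (int p)" using odd_p by simp
  hence "even b" using ab a by auto
  then obtain y where "b = 2 * y" by blast
  hence "int p = a\<^sup>2 + 4 * y\<^sup>2" using ab by (simp add: power_mult_distrib)
  thus "\<exists>x y. int p = x\<^sup>2 + 4 * y\<^sup>2" by blast
  fix x y assume xy: "int p = x\<^sup>2 + 4 * y\<^sup>2"
  hence "odd x" using odd by auto
  moreover have "int p = x\<^sup>2 + (2 * y)\<^sup>2" using xy by (simp add: power_mult_distrib)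
  ultimately have "x\<^sup>2 = a\<^sup>2" using two_squares_unique[OF prime_int_p odd] a ab by blast
  thus "(J (-1))\<^sup>2 = 4 * x\<^sup>2" unfolding J by (simp add: power_mult_distrib)
qed

section \<open>The 2-isogeny between the two curves\<close>

lemma rsum_quadratic_roots:
  "rsum (\<lambda>x. of_bool [x * y = x\<^sup>2 + 1] (mod int p)) = 1 + chi (y\<^sup>2 - 4)"
proof -
  have iff: "[x * y = x\<^sup>2 + 1] (mod int p) \<longleftrightarrow> [1 * (2 * x + (- y))\<^sup>2 = y\<^sup>2 - 4] (mod int p)" for x
  proof -
    have "1 * (2 * x + (- y))\<^sup>2 - (y\<^sup>2 - 4) = - (4 * (x * y - (x\<^sup>2 + 1)))"
      by (simp add: power2_eq_square algebra_simps)
    moreover have "\<not> int p dvd 4"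
      using not_dvd_2 p_dvd_mult_iff[of 2 2] by simp
    ultimately show ?thesis by (simp only: cong_iff_dvd_diff dvd_minus_iff p_dvd_mult_iff) simp
  qed
  have per: "periodic (\<lambda>z. of_bool [1 * z\<^sup>2 = y\<^sup>2 - 4] (mod int p))"
    unfolding periodic_def cong_def by (metis mod_mult_right_eq power_mod)
  have per2: "periodic (\<lambda>z. of_bool [1 * (z + (- y))\<^sup>2 = y\<^sup>2 - 4] (mod int p))"
    unfolding periodic_def using periodicD[OF per cong_add[OF _ cong_refl]] by blast
  have "rsum (\<lambda>x. of_bool [x * y = x\<^sup>2 + 1] (mod int p))
     = rsum (\<lambda>x. of_bool [1 * (2 * x + (- y))\<^sup>2 = y\<^sup>2 - 4] (mod int p))"
    unfolding iff ..
  also have "\<dots> = rsum (\<lambda>x. of_bool [1 * (x + (- y))\<^sup>2 = y\<^sup>2 - 4] (mod int p))"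
    by (rule rsum_scale[OF per2 not_dvd_2])
  also have "\<dots> = rsum (\<lambda>x. of_bool [1 * x\<^sup>2 = y\<^sup>2 - 4] (mod int p))"
    by (rule rsum_shift[OF per])
  finally show ?thesis using rsum_roots_mult[of 1] p_gt3 by simp
qed

text \<open>The 2-isogeny in elementary form: \<open>chi (x (x^2 + 6x + 1)) = chi (x + 1/x + 6)\<close> for \<open>x \<noteq> 0\<close>,
  and \<open>x + 1/x = y\<close> has \<open>1 + chi (y^2 - 4)\<close> solutions.\<close>

lemma rsum_isogeny: "rsum (\<lambda>x. chi (x * (x\<^sup>2 + 6 * x + 1))) = J (-1)"
proof -
  have inner: "chi (x * (x\<^sup>2 + 6 * x + 1)) =
      rsum (\<lambda>y. of_bool [x * y = x\<^sup>2 + 1] (mod int p) * chi (y + 6))"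
    if x: "x \<in> {0..<int p}" for x
  proof (cases "x = 0")
    case True
    have "\<not> [0 = 1] (mod int p)" using p_gt3 by (simp add: cong_iff_dvd_diff)
    thus ?thesis using True by (simp add: rsum_def)
  next
    case False
    have nx: "\<not> int p dvd x" by (rule not_dvd_residue[OF x False])
    obtain s where s: "[x * s = 1] (mod int p)" using inverse_exists[OF nx] by blast
    define y0 where "y0 = (s * (x\<^sup>2 + 1)) mod int p"
    have y0R: "y0 \<in> {0..<int p}" unfolding y0_def using p_gt3 by simp
    have y0: "[x * y0 = x\<^sup>2 + 1] (mod int p)"
    proof -
      have "[x * y0 = (x * s) * (x\<^sup>2 + 1)] (mod int p)"
        unfolding y0_def cong_def by (simp add: mod_mult_right_eq mult.assoc)
      also have "[(x * s) * (x\<^sup>2 + 1) = 1 * (x\<^sup>2 + 1)] (mod int p)"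
        by (rule cong_scalar_right[OF s])
      finally show ?thesis by simp
    qed
    have uniq: "[x * y = x\<^sup>2 + 1] (mod int p) \<longleftrightarrow> y = y0" if y: "y \<in> {0..<int p}" for y
    proof
      assume "[x * y = x\<^sup>2 + 1] (mod int p)"
      from cong_trans[OF this cong_sym[OF y0]] have "[y = y0] (mod int p)"
        by (rule cong_mult_cancel[OF nx])
      thus "y = y0" using y y0R by (simp add: cong_def)
    qed (use y0 in simp)
    have "rsum (\<lambda>y. of_bool [x * y = x\<^sup>2 + 1] (mod int p) * chi (y + 6))
      = (\<Sum>y\<in>{0..<int p}. if y = y0 then chi (y + 6) else 0)"
      unfolding rsum_def by (rule sum.cong) (simp_all add: uniq)
    also have "\<dots> = chi (y0 + 6)" using y0R by simp
    also have "\<dots> = chi (x\<^sup>2 * (y0 + 6))"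
      using nx by (simp only: chi_mult chi_power2) simp
    also have "x\<^sup>2 * (y0 + 6) = x * (x * y0 + 6 * x)" by (simp add: power2_eq_square algebra_simps)
    also have "chi (x * (x * y0 + 6 * x)) = chi (x * ((x\<^sup>2 + 1) + 6 * x))"
      by (intro chi_cong cong_mult cong_add cong_refl y0)
    finally show ?thesis by (simp add: algebra_simps)
  qed
  have per: "periodic (\<lambda>y. chi (y + c))" for c
    by (intro periodic_comp_chi cong_add cong_refl)
  have per3: "periodic (\<lambda>y. chi ((y + 6) * (y\<^sup>2 - 4)))"
    by (intro periodic_comp_chi cong_mult cong_add cong_diff cong_pow cong_refl)
  have per4: "periodic (\<lambda>y. chi (y * (y\<^sup>2 - 16)))"
    by (intro periodic_comp_chi cong_mult cong_add cong_diff cong_pow cong_refl)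
  have "rsum (\<lambda>x. chi (x * (x\<^sup>2 + 6 * x + 1)))
     = rsum (\<lambda>x. rsum (\<lambda>y. of_bool [x * y = x\<^sup>2 + 1] (mod int p) * chi (y + 6)))"
    by (rule rsum_cong) (rule inner)
  also have "\<dots> = rsum (\<lambda>y. rsum (\<lambda>x. chi (y + 6) * of_bool [x * y = x\<^sup>2 + 1] (mod int p)))"
    by (subst rsum_swap) (simp add: mult.commute)
  also have "\<dots> = rsum (\<lambda>y. chi (y + 6) + chi ((y + 6) * (y\<^sup>2 - 4)))"
    by (rule rsum_cong) (simp only: rsum_mult_left rsum_quadratic_roots, simp add: chi_mult distrib_left)
  also have "\<dots> = rsum (\<lambda>y. chi ((y + 6) * (y\<^sup>2 - 4)))"
    using rsum_shift[of chi 6] periodic_comp_chi[of "\<lambda>x. x"] by (simp add: rsum_add rsum_chi)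
  \<comment> \<open>The roots -6, -2, 2 are in arithmetic progression: centring at -2 and dividing
    by 4 turns them into -1, 0, 1.\<close>
  also have "\<dots> = rsum (\<lambda>y. chi (((y + (-2)) + 6) * ((y + (-2))\<^sup>2 - 4)))"
    by (rule rsum_shift[OF per3, symmetric])
  also have "\<dots> = rsum (\<lambda>y. chi (y * (y\<^sup>2 - 16)))"
    by (rule rsum_cong) (simp add: power2_eq_square algebra_simps)
  also have "\<dots> = rsum (\<lambda>y. chi ((4 * y) * ((4 * y)\<^sup>2 - 16)))"
    using rsum_scale[OF per4, of 4] not_dvd_2 p_dvd_mult_iff[of 2 2] by simp
  also have "\<dots> = J (-1)"
    unfolding J_def
  proof (rule rsum_cong)
    fix y :: int
    have "(4 * y) * ((4 * y)\<^sup>2 - 16) = 8\<^sup>2 * (y * (y\<^sup>2 + -1))" by (simp add: power2_eq_square algebra_simps)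
    moreover have "\<not> int p dvd 8"
      using not_dvd_2 p_dvd_power_iff[of 3 2] by simp
    ultimately show "chi ((4 * y) * ((4 * y)\<^sup>2 - 16)) = chi (y * (y\<^sup>2 + -1))"
      by (simp only: chi_mult[of "8\<^sup>2"] chi_power2) simp
  qed
  finally show ?thesis .
qed

text \<open>The cubic has the root 6. Moving it to 0 and scaling x by 3 gives 27 x (x^2 + 6 x + 1),
  to which the isogeny applies; squaring removes the symbol of 27.\<close>

lemma rsum_cubic: "(rsum (\<lambda>x. chi (x ^ 3 - 3 * 33 * x + 2 * 189)))\<^sup>2 = (J (-1))\<^sup>2"
proof -
  have per: "periodic (\<lambda>x. chi (x ^ 3 - 3 * 33 * x + 2 * 189))"
    by (intro periodic_comp_chi cong_mult cong_add cong_diff cong_pow cong_refl)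
  have per2: "periodic (\<lambda>x. chi (x * (x\<^sup>2 + 18 * x + 9)))"
    by (intro periodic_comp_chi cong_mult cong_add cong_diff cong_pow cong_refl)
  have "rsum (\<lambda>x. chi (x ^ 3 - 3 * 33 * x + 2 * 189))
    = rsum (\<lambda>x. chi ((x + 6) ^ 3 - 3 * 33 * (x + 6) + 2 * 189))"
    by (rule rsum_shift[OF per, symmetric])
  also have "\<dots> = rsum (\<lambda>x. chi (x * (x\<^sup>2 + 18 * x + 9)))"
    by (rule rsum_cong) (simp add: power2_eq_square power3_eq_cube algebra_simps)
  also have "\<dots> = rsum (\<lambda>x. chi ((3 * x) * ((3 * x)\<^sup>2 + 18 * (3 * x) + 9)))"
    by (rule rsum_scale[OF per2 not_dvd_3, symmetric])
  also have "\<dots> = rsum (\<lambda>x. chi 27 * chi (x * (x\<^sup>2 + 6 * x + 1)))"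
    by (rule rsum_cong) (simp add: chi_mult[symmetric] power2_eq_square algebra_simps)
  also have "\<dots> = chi 27 * J (-1)" by (simp only: rsum_mult_left rsum_isogeny)
  finally have "(rsum (\<lambda>x. chi (x ^ 3 - 3 * 33 * x + 2 * 189)))\<^sup>2 = (chi 27 * chi 27) * (J (-1))\<^sup>2"
    by (simp add: power2_eq_square)
  moreover have "\<not> int p dvd 27" using not_dvd_3 p_dvd_power_iff[of 3 3] by simp
  ultimately show ?thesis by (simp add: chi_square)
qed

end

section \<open>Reduction of the sum modulo p\<close>

lemma Suc_times_choose_Suc:
  "(int n + 1) * int (k choose Suc n) = (int k - int n) * int (k choose n)"
proof -
  have "Suc k * (k choose n) = ((k choose n) + (k choose Suc n)) * Suc n"
    using Suc_times_binomial_eq[of k n] by simp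
  hence "int (Suc k * (k choose n)) = int (((k choose n) + (k choose Suc n)) * Suc n)" by simp
  thus ?thesis by (simp add: algebra_simps)
qed

lemma Suc_times_central_binomial:
  "(n + 1) * ((2 * (n + 1)) choose (n + 1)) = 2 * (2 * n + 1) * ((2 * n) choose n)"
proof -
  have "(2 * n + 1) choose n = (2 * n + 1) choose Suc n"
    using binomial_symmetric[of n "2 * n + 1"] by simp
  hence "(2 * (n + 1)) choose (n + 1) = 2 * (Suc (2 * n) choose Suc n)" by simp
  moreover have "Suc (2 * n) * ((2 * n) choose n) = (Suc (2 * n) choose Suc n) * Suc n"
    by (rule Suc_times_binomial_eq)
  ultimately show ?thesis by (simp add: algebra_simps del: binomial_Suc_Suc)
qed

text \<open>C(n,i) C(i,j) = C(n,j) C(n-j,i-j), followed by the binomial theorem. For i < j the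
  truncated exponent is harmless, because the coefficient is 0. This eliminates the summation index
  n of the terms \<open>W n\<close>.\<close>

lemma sum_choose_mult_choose:
  fixes a b :: "'a :: comm_ring_1"
  assumes "j \<le> n"
  shows "(\<Sum>i\<le>n. of_nat (n choose i) * of_nat (i choose j) * a ^ i * b ^ (i - j))
    = of_nat (n choose j) * a ^ j * (1 + a * b) ^ (n - j)"
proof -
  have "(\<Sum>i\<le>n. of_nat (n choose i) * of_nat (i choose j) * a ^ i * b ^ (i - j))
      = (\<Sum>i\<in>{j..n}. of_nat (n choose i) * of_nat (i choose j) * a ^ i * b ^ (i - j))"
    by (rule sum.mono_neutral_right) (auto simp: not_le binomial_eq_0)
  also have "\<dots> = (\<Sum>i\<le>n - j. of_nat (n choose (i + j)) * of_nat ((i + j) choose j) * a ^ (i + j) * b ^ i)"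
    by (rule sum.reindex_bij_witness[of _ "\<lambda>i. i + j" "\<lambda>i. i - j"]) (use assms in auto)
  also have "\<dots> = (\<Sum>i\<le>n - j. of_nat (n choose j) * a ^ j * (of_nat ((n - j) choose i) * (a * b) ^ i))"
  proof (rule sum.cong[OF refl])
    fix i assume "i \<in> {..n - j}"
    hence "(n choose (i + j)) * ((i + j) choose j) = (n choose j) * ((n - j) choose i)"
      using choose_mult[of j "i + j" n] assms by simp
    hence "of_nat (n choose (i + j)) * of_nat ((i + j) choose j)
        = (of_nat (n choose j) * of_nat ((n - j) choose i) :: 'a)"
      by (metis of_nat_mult)
    thus "of_nat (n choose (i + j)) * of_nat ((i + j) choose j) * a ^ (i + j) * b ^ i
        = of_nat (n choose j) * a ^ j * (of_nat ((n - j) choose i) * (a * b) ^ i)"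
      by (simp add: power_add power_mult_distrib mult_ac)
  qed
  also have "\<dots> = of_nat (n choose j) * a ^ j * (1 + a * b) ^ (n - j)"
  proof -
    have "(1 + a * b) ^ (n - j) = (a * b + 1) ^ (n - j)" by (simp add: add.commute)
    also have "\<dots> = (\<Sum>i\<le>n - j. of_nat ((n - j) choose i) * (a * b) ^ i)"
      by (simp only: binomial_ring) simp
    finally show ?thesis by (simp only: sum_distrib_left)
  qed
  finally show ?thesis .
qed

text \<open>The multinomial coefficient n! / (k!^3 (n - 3 k)!), as the product of binomials in which
  it arises from \<open>W\<close>; this form is 0 for n < 3 k.\<close>

definition mu :: "nat \<Rightarrow> nat \<Rightarrow> nat" where
  "mu n k = (n choose (3 * k)) * ((3 * k) choose k) * ((2 * k) choose k)"

lemma mu_fact: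
  assumes "3 * k \<le> n"
  shows "mu n k * (fact k ^ 3 * fact (n - 3 * k)) = fact n"
proof -
  have 1: "fact k * fact k * ((2 * k) choose k) = fact (2 * k)"
    using binomial_fact_lemma[of k "2 * k"] by simp
  have 2: "fact k * fact (2 * k) * ((3 * k) choose k) = fact (3 * k)"
    using binomial_fact_lemma[of k "3 * k"] by simp
  have 3: "fact (3 * k) * fact (n - 3 * k) * (n choose (3 * k)) = fact n"
    by (rule binomial_fact_lemma[OF assms])
  have "fact n = fact k * (fact k * fact k * ((2 * k) choose k)) * ((3 * k) choose k)
      * fact (n - 3 * k) * (n choose (3 * k))"
    by (simp only: 1 2 3[symmetric])
  thus ?thesis unfolding mu_def by (simp add: power3_eq_cube mult_ac)
qed

lemma mu_eq_0: "n < 3 * k \<Longrightarrow> mu n k = 0"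
  by (simp add: mu_def)

text \<open>Stated over the integers so that it holds for all k: if 3 k \<le> n < 3 k + 3, one of
  the three factors is 0.\<close>

lemma mu_Suc:
  "(int k + 1) ^ 3 * int (mu n (Suc k))
    = (int n - 3 * int k) * (int n - 3 * int k - 1) * (int n - 3 * int k - 2) * int (mu n k)"
proof (cases "3 * Suc k \<le> n")
  case True
  define d where "d = n - 3 * Suc k"
  have n: "n = d + 3 * k + 3" using True by (simp add: d_def)
  have f: "fact (n - 3 * k) = (d + 3) * ((d + 2) * ((d + 1) * fact d))"
    unfolding n by (simp add: numeral_3_eq_3 algebra_simps)
  have "mu n (Suc k) * (fact (Suc k) ^ 3 * fact d) = mu n k * (fact k ^ 3 * fact (n - 3 * k))"
    using mu_fact[OF True] mu_fact[of k n] True by (simp add: d_def)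
  moreover have "fact (Suc k) ^ 3 = (k + 1) ^ 3 * fact k ^ 3"
    by (simp only: fact_Suc power_mult_distrib of_nat_id Suc_eq_plus1[symmetric])
  ultimately have "(fact k ^ 3 * fact d) * ((k + 1) ^ 3 * mu n (Suc k))
      = (fact k ^ 3 * fact d) * ((d + 3) * (d + 2) * (d + 1) * mu n k)"
    unfolding f by (simp only: mult_ac)
  hence "(k + 1) ^ 3 * mu n (Suc k) = (d + 3) * (d + 2) * (d + 1) * mu n k" by simp
  hence "int ((k + 1) ^ 3 * mu n (Suc k)) = int ((d + 3) * (d + 2) * (d + 1) * mu n k)" by simp
  thus ?thesis by (simp add: n algebra_simps)
next
  case False
  hence "mu n (Suc k) = 0" by (intro mu_eq_0) simp
  moreover have "(int n - 3 * int k) * (int n - 3 * int k - 1) * (int n - 3 * int k - 2) * int (mu n k) = 0"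
  proof (cases "3 * k \<le> n")
    case True
    then obtain d where "n = 3 * k + d" using le_Suc_ex by blast
    moreover have "d = 0 \<or> d = 1 \<or> d = 2" using False calculation by auto
    ultimately show ?thesis by auto
  qed (simp add: mu_eq_0)
  ultimately show ?thesis by simp
qed

lemma W_eq_sum:
  assumes "n \<le> N"
  shows "W n = (\<Sum>k\<le>N div 3. int ((2 * k) choose k) * int ((3 * k) choose k)
            * int (n choose (3 * k)) * (-3) ^ (n - 3 * k))"
  unfolding W_def by (rule sum.mono_neutral_left) (use assms in \<open>auto simp: div_le_mono\<close>)

context prime_gt3 begin

lemma int_p_eq: "int p = 2 * int m + 1"
  using p_eq by simp

lemma two_m_cong: "[2 * int m = -1] (mod int p)"
  unfolding cong_iff_dvd_diff int_p_eq by simp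

text \<open>C(2n, n) = (-4)^n C(-1/2, n), and m represents -1/2 modulo p. The induction divides by
  each positive integer up to n, hence n < p.\<close>

lemma central_binomial_cong:
  "n < p \<Longrightarrow> [int ((2 * n) choose n) = int (m choose n) * (-4) ^ n] (mod int p)"
proof (induction n)
  case (Suc n)
  have "(int n + 1) * int ((2 * Suc n) choose Suc n) = 2 * (2 * int n + 1) * int ((2 * n) choose n)"
    using arg_cong[OF Suc_times_central_binomial[of n], of int] by (simp add: algebra_simps)
  also have "[2 * (2 * int n + 1) * int ((2 * n) choose n)
      = 2 * (2 * int n - 2 * int m) * (int (m choose n) * (-4) ^ n)] (mod int p)"
  proof (intro cong_mult cong_refl)
    show "[2 * int n + 1 = 2 * int n - 2 * int m] (mod int p)"
      unfolding cong_iff_dvd_diff int_p_eq by (simp add: add.commute)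
  qed (use Suc in simp)
  also have "2 * (2 * int n - 2 * int m) * (int (m choose n) * (-4) ^ n)
      = ((int m - int n) * int (m choose n)) * (-4) ^ Suc n"
    by (simp add: algebra_simps)
  also have "\<dots> = (int n + 1) * (int (m choose Suc n) * (-4) ^ Suc n)"
    unfolding Suc_times_choose_Suc[symmetric] by (simp add: mult_ac)
  finally have c: "[(int n + 1) * int ((2 * Suc n) choose Suc n)
      = (int n + 1) * (int (m choose Suc n) * (-4) ^ Suc n)] (mod int p)" .
  have "\<not> int p dvd int n + 1" using not_dvd_small[of "Suc n"] Suc.prems by (simp add: add.commute)
  thus ?case using c by (rule cong_mult_cancel)
qed simp

text \<open>Inserting 2 m = -1 makes the recurrence independent of p: up to powers of -27 it is that
  of the coefficients of 3F2(1/6, 1/2, 5/6; 1, 1).\<close>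

lemma mu_Suc_cong:
  "[8 * (int k + 1) ^ 3 * int (mu m (Suc k))
    = - ((6 * int k + 1) * (6 * int k + 3) * (6 * int k + 5)) * int (mu m k)] (mod int p)"
proof -
  let ?k = "int k"
  have "8 * (?k + 1) ^ 3 * int (mu m (Suc k)) = 8 * ((?k + 1) ^ 3 * int (mu m (Suc k)))" by simp
  also have "\<dots> = (2 * int m - 6 * ?k) * (2 * int m - 6 * ?k - 2) * (2 * int m - 6 * ?k - 4) * int (mu m k)"
    unfolding mu_Suc by (simp add: algebra_simps)
  also have "[\<dots> = (-1 - 6 * ?k) * (-1 - 6 * ?k - 2) * (-1 - 6 * ?k - 4) * int (mu m k)] (mod int p)"
    by (intro cong_mult cong_diff cong_refl two_m_cong)
  finally show ?thesis by (simp add: algebra_simps)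
qed

definition hsum :: int where
  "hsum = (\<Sum>k\<le>m div 3. int (mu m k) * (-8) ^ k * 33 ^ (m - 3 * k))"

lemma sum_W_cong:
  assumes g: "[54 * g = 1] (mod int p)"
  shows "[27 ^ m * (\<Sum>n<p. int ((2 * n) choose n) * W n * g ^ n) = hsum] (mod int p)"
proof -
  define b where "b = (\<lambda>k. int ((2 * k) choose k) * int ((3 * k) choose k))"
  have "[(\<Sum>n<p. int ((2 * n) choose n) * W n * g ^ n)
      = (\<Sum>n<p. int (m choose n) * (-4) ^ n * W n * g ^ n)] (mod int p)"
    by (intro cong_sum cong_mult cong_refl central_binomial_cong) simp
  also have "(\<Sum>n<p. int (m choose n) * (-4) ^ n * W n * g ^ n)
      = (\<Sum>n\<le>m. int (m choose n) * (-4) ^ n * W n * g ^ n)"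
    by (rule sum.mono_neutral_right) (use p_eq in auto)
  also have "\<dots> = (\<Sum>n\<le>m. \<Sum>k\<le>m div 3.
      b k * (int (m choose n) * int (n choose (3 * k)) * (-4 * g) ^ n * (-3) ^ (n - 3 * k)))"
  proof (rule sum.cong[OF refl])
    fix n assume "n \<in> {..m}"
    hence "n \<le> m" by simp
    show "int (m choose n) * (-4) ^ n * W n * g ^ n = (\<Sum>k\<le>m div 3.
      b k * (int (m choose n) * int (n choose (3 * k)) * (-4 * g) ^ n * (-3) ^ (n - 3 * k)))"
      unfolding W_eq_sum[OF \<open>n \<le> m\<close>] b_def sum_distrib_left sum_distrib_right power_mult_distrib
      by (intro sum.cong refl) (simp add: mult_ac)
  qed
  also have "\<dots> = (\<Sum>k\<le>m div 3. b k * (\<Sum>n\<le>m.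
      int (m choose n) * int (n choose (3 * k)) * (-4 * g) ^ n * (-3) ^ (n - 3 * k)))"
    by (subst sum.swap) (simp add: sum_distrib_left)
  also have "\<dots> = (\<Sum>k\<le>m div 3. int (mu m k) * (-4 * g) ^ (3 * k) * (1 + 12 * g) ^ (m - 3 * k))"
  proof (rule sum.cong[OF refl])
    fix k assume "k \<in> {..m div 3}"
    hence "3 * k \<le> m" by auto
    from sum_choose_mult_choose[OF this, of "-4 * g" "-3"]
    show "b k * (\<Sum>n\<le>m. int (m choose n) * int (n choose (3 * k)) * (-4 * g) ^ n * (-3) ^ (n - 3 * k))
      = int (mu m k) * (-4 * g) ^ (3 * k) * (1 + 12 * g) ^ (m - 3 * k)"
      by (simp add: b_def mu_def mult_ac)
  qed
  finally have "[27 ^ m * (\<Sum>n<p. int ((2 * n) choose n) * W n * g ^ n)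
    = 27 ^ m * (\<Sum>k\<le>m div 3. int (mu m k) * (-4 * g) ^ (3 * k) * (1 + 12 * g) ^ (m - 3 * k))] (mod int p)"
    by (rule cong_scalar_left)
  \<comment> \<open>The m factors 27 are spread over the powers so that g occurs only in 54 g, which
    is 1 modulo p: 27 (-4 g) = -2 (54 g) becomes -2, and 27 (1 + 12 g) = 27 + 6 (54 g) becomes
    33.\<close>
  also have "27 ^ m * (\<Sum>k\<le>m div 3. int (mu m k) * (-4 * g) ^ (3 * k) * (1 + 12 * g) ^ (m - 3 * k))
    = (\<Sum>k\<le>m div 3. int (mu m k) * (-2 * (54 * g)) ^ (3 * k) * (27 + 6 * (54 * g)) ^ (m - 3 * k))"
    unfolding sum_distrib_left
  proof (rule sum.cong[OF refl])
    fix k assume "k \<in> {..m div 3}"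
    hence "27 ^ m = (27 :: int) ^ (3 * k) * 27 ^ (m - 3 * k)" by (simp add: power_add[symmetric])
    moreover have "(-2 * (54 * g)) ^ (3 * k) = (27 * (-4 * g)) ^ (3 * k)" by simp
    moreover have "(27 + 6 * (54 * g)) ^ (m - 3 * k) = (27 * (1 + 12 * g)) ^ (m - 3 * k)"
      by (simp add: algebra_simps)
    ultimately show "27 ^ m * (int (mu m k) * (-4 * g) ^ (3 * k) * (1 + 12 * g) ^ (m - 3 * k))
      = int (mu m k) * (-2 * (54 * g)) ^ (3 * k) * (27 + 6 * (54 * g)) ^ (m - 3 * k)"
      by (simp only: power_mult_distrib mult_ac)
  qed
  also have "[\<dots> = (\<Sum>k\<le>m div 3. int (mu m k) * (-2 * 1) ^ (3 * k) * (27 + 6 * 1) ^ (m - 3 * k))] (mod int p)"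
    by (intro cong_sum cong_mult cong_pow cong_add cong_refl g)
  also have "(\<Sum>k\<le>m div 3. int (mu m k) * (-2 * 1) ^ (3 * k) * (27 + 6 * 1) ^ (m - 3 * k)) = hsum"
    unfolding hsum_def by (simp add: power_mult)
  finally show ?thesis .
qed

end

section \<open>The Hasse invariant and Clausen's identity\<close>

text \<open>With \<open>n = (p - 1) / 2\<close>, the coefficient of \<open>x^(2n)\<close> in \<open>(x^3 - 3wx + 2v)^n\<close> is the sum of
  \<open>rho n w j * v^e\<close> over \<open>e = 2j + n mod 2\<close>: only exponents of the parity of \<open>n\<close> occur, and the
  coefficient of \<open>v^e\<close> is multinomial.\<close>

definition rho :: "nat \<Rightarrow> int \<Rightarrow> nat \<Rightarrow> int" where
  "rho n w j = (let e = 2 * j + n mod 2 in if 3 * e \<le> n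
     then int (n choose e) * int ((n - e) choose ((n - 3 * e) div 2)) * 2 ^ e * (-3 * w) ^ ((n - 3 * e) div 2)
     else 0)"

text \<open>The multinomial coefficient belonging to (2v)^e (-3wx)^l (x^3)^(2e+l), where the
  exponent of x is l + 3 (2 e + l) = 2 n.\<close>

lemma rho_fact:
  assumes e: "e = 2 * j + n mod 2" and n: "n = 3 * e + 2 * l"
  shows "rho n w j * (fact e * fact l * fact (2 * e + l)) = fact n * 2 ^ e * (-3 * w) ^ l"
proof -
  have r: "rho n w j = int (n choose e) * int ((n - e) choose l) * 2 ^ e * (-3 * w) ^ l"
    unfolding rho_def Let_def e[symmetric] using n by simp
  have "n - e - l = 2 * e + l" using n by simp
  moreover have "fact l * fact (n - e - l) * ((n - e) choose l) = fact (n - e)"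
    by (rule binomial_fact_lemma) (use n in simp)
  ultimately have "fact l * fact (2 * e + l) * ((n - e) choose l) = fact (n - e)" by simp
  moreover have "fact e * fact (n - e) * (n choose e) = fact n"
    using binomial_fact_lemma[of e n] n by simp
  ultimately have "fact e * (fact l * fact (2 * e + l) * ((n - e) choose l)) * (n choose e) = fact n"
    by simp
  hence "int (fact e * (fact l * fact (2 * e + l) * ((n - e) choose l)) * (n choose e)) = int (fact n)"
    by simp
  hence "int (n choose e) * int ((n - e) choose l) * (fact e * fact l * fact (2 * e + l)) = fact n"
    by (simp add: mult_ac)
  thus ?thesis unfolding r by (simp add: mult_ac)
qed

lemma rho_index:
  fixes e j n :: nat
  assumes "e = 2 * j + n mod 2" "3 * e \<le> n"
  obtains l where "n = 3 * e + 2 * l"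
proof
  have "even n \<longleftrightarrow> even e" using assms(1) by simp
  hence "even (n - 3 * e)" using assms(2) by simp
  thus "n = 3 * e + 2 * ((n - 3 * e) div 2)" using assms(2) by simp
qed

lemma rho_eq_0: "n < 3 * (2 * j + n mod 2) \<Longrightarrow> rho n w j = 0"
  by (simp add: rho_def Let_def)

text \<open>From j to j + 1, e grows by 2, l drops by 3 and 2 e + l grows by 1. For l < 3 both sides
  are 0.\<close>

lemma rho_Suc:
  assumes e: "e = 2 * j + n mod 2" and n: "n = 3 * e + 2 * l"
  shows "rho n w (Suc j) * ((int e + 1) * (int e + 2) * (2 * int e + int l + 1)) * (-27 * w ^ 3)
    = 4 * (int l * (int l - 1) * (int l - 2)) * rho n w j"
proof (cases "l \<ge> 3")
  case True
  then obtain d where l: "l = d + 3" using le_Suc_ex by (metis add.commute)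
  have fe: "fact (e + 2) = (int e + 1) * (int e + 2) * fact e"
    by (simp add: algebra_simps)
  have fl: "fact l = int l * (int l - 1) * (int l - 2) * fact d"
    unfolding l by (simp add: numeral_3_eq_3 algebra_simps)
  have fi: "fact (2 * (e + 2) + d) = (2 * int e + int l + 1) * fact (2 * e + l)"
  proof -
    have "2 * (e + 2) + d = Suc (2 * e + l)" using l by simp
    thus ?thesis by (simp only: fact_Suc) simp
  qed
  have n': "n = 3 * (e + 2) + 2 * d" using n l by simp
  have "rho n w (Suc j) * (fact (e + 2) * fact d * fact (2 * (e + 2) + d))
    = fact n * 2 ^ (e + 2) * (-3 * w) ^ d"
    by (rule rho_fact[OF _ n']) (simp add: e)
  hence "rho n w (Suc j) * (fact (e + 2) * fact d * fact (2 * (e + 2) + d)) * (-27 * w ^ 3)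
    = 4 * (fact n * 2 ^ e * (-3 * w) ^ l)"
    unfolding l by (simp add: power_add power_mult_distrib power3_eq_cube)
  also have "\<dots> = 4 * (rho n w j * (fact e * fact l * fact (2 * e + l)))"
    by (simp only: rho_fact[OF e n])
  finally have "(fact e * fact d * fact (2 * e + l)) *
      (rho n w (Suc j) * ((int e + 1) * (int e + 2) * (2 * int e + int l + 1)) * (-27 * w ^ 3))
    = (fact e * fact d * fact (2 * e + l)) *
      (4 * (int l * (int l - 1) * (int l - 2)) * rho n w j)"
    unfolding fe fl fi by (simp only: mult_ac)
  moreover have "fact e * fact d * fact (2 * e + l) \<noteq> (0 :: int)" by simp
  ultimately show ?thesis by (simp only: mult_cancel_left) blast
next
  case False
  hence "rho n w (Suc j) = 0" using n by (intro rho_eq_0) (simp add: e)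
  moreover have "l = 0 \<or> l = 1 \<or> l = 2" using False by auto
  ultimately show ?thesis by auto
qed

text \<open>The equation 3 i + 2 l = n forces i to have the parity of n, so i = 2 j + n mod 2, and i
  determines l.\<close>

lemma sum_weighted_pairs:
  fixes f :: "nat \<Rightarrow> nat \<Rightarrow> int"
  shows "(\<Sum>i\<le>n. \<Sum>l\<le>n - i. if 3 * i + 2 * l = n then f i l else 0)
    = (\<Sum>j\<le>n. let e = 2 * j + n mod 2 in if 3 * e \<le> n then f e ((n - 3 * e) div 2) else 0)"
proof -
  define E where "E = (\<lambda>j. 2 * j + n mod 2)"
  let ?A = "{(i, l). 3 * i + 2 * l = n}"
  let ?B = "{j. 3 * E j \<le> n}"
  have E_half: "E (i div 2) = i" if "3 * i + 2 * l = n" for i l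
  proof -
    have "n mod 2 = i mod 2" unfolding that[symmetric] by presburger
    thus ?thesis by (simp add: E_def)
  qed
  have E_index: "3 * E j + 2 * ((n - 3 * E j) div 2) = n" if "3 * E j \<le> n" for j
  proof -
    have "even n \<longleftrightarrow> even (E j)" by (simp add: E_def)
    hence "even (n - 3 * E j)" using that by simp
    thus ?thesis using that by simp
  qed
  have "(\<Sum>i\<le>n. \<Sum>l\<le>n - i. if 3 * i + 2 * l = n then f i l else 0)
    = (\<Sum>(i, l)\<in>Sigma {..n} (\<lambda>i. {..n - i}). if 3 * i + 2 * l = n then f i l else 0)"
    by (rule sum.Sigma) auto
  also have "\<dots> = (\<Sum>(i, l)\<in>?A. f i l)"
    by (rule sum.mono_neutral_cong_right) (auto split: if_splits)
  also have "\<dots> = (\<Sum>j\<in>?B. f (E j) ((n - 3 * E j) div 2))"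
  proof (rule sum.reindex_bij_witness[of _ "\<lambda>j. (E j, (n - 3 * E j) div 2)" "\<lambda>a. fst a div 2"])
    fix a assume "a \<in> ?A"
    then obtain i l where a: "a = (i, l)" and n: "3 * i + 2 * l = n" by auto
    have l: "(n - 3 * i) div 2 = l" unfolding n[symmetric] by simp
    show "(E (fst a div 2), (n - 3 * E (fst a div 2)) div 2) = a"
      unfolding a fst_conv E_half[OF n] l ..
    show "fst a div 2 \<in> ?B"
      unfolding a fst_conv mem_Collect_eq E_half[OF n] by (simp add: n[symmetric])
    show "f (E (fst a div 2)) ((n - 3 * E (fst a div 2)) div 2) = (case a of (i, l) \<Rightarrow> f i l)"
      unfolding a fst_conv E_half[OF n] l by simp
  next
    fix j assume "j \<in> ?B"
    thus "(E j, (n - 3 * E j) div 2) \<in> ?A" using E_index by simp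
    show "fst (E j, (n - 3 * E j) div 2) div 2 = j" by (simp add: E_def)
  qed
  also have "\<dots> = (\<Sum>j\<le>n. if 3 * E j \<le> n then f (E j) ((n - 3 * E j) div 2) else 0)"
    by (rule sum.mono_neutral_cong_left) (auto simp: E_def)
  finally show ?thesis by (simp only: E_def Let_def)
qed

context prime_gt3 begin

text \<open>Since 3 m < 2 (p - 1), the only positive multiple of p - 1 in range is p - 1 = 2 m
  itself; the exponent 0 contributes p.\<close>

lemma rsum_power_cong:
  assumes "e \<le> 3 * m"
  shows "[rsum (\<lambda>x. x ^ e) = (if e = 2 * m then -1 else 0)] (mod int p)"
proof -
  have pm: "p - 1 = 2 * m" using p_eq by simp
  show ?thesis
  proof (cases "e = 2 * m")
    case True
    thus ?thesis using rsum_power_p_minus_1[unfolded pm] by simp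
  next
    case ne: False
    show ?thesis
    proof (cases "e = 0")
      case True
      thus ?thesis using m_ge2 by (simp add: rsum_def cong_iff_dvd_diff)
    next
      case False
      have "\<not> (p - 1) dvd e"
      proof
        assume "(p - 1) dvd e"
        then obtain c where c: "e = 2 * m * c" unfolding pm by (elim dvdE)
        hence "c \<ge> 2" using ne False by (cases c; cases "c - 1") auto
        hence "2 * m * 2 \<le> e" unfolding c by (intro mult_le_mono) auto
        thus False using assms m_ge2 by simp
      qed
      thus ?thesis using rsum_power ne by simp
    qed
  qed
qed

lemma rsum_sum: "rsum (\<lambda>x. \<Sum>i\<in>A. f i x) = (\<Sum>i\<in>A. rsum (f i))"
  unfolding rsum_def by (rule sum.swap)

lemma rsum_cubic_power:
  "[rsum (\<lambda>x. (x ^ 3 - 3 * w * x + 2 * v) ^ m) = - (\<Sum>j\<le>m. rho m w j * v ^ (2 * j + m mod 2))] (mod int p)"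
proof -
  define c where "c = (\<lambda>i l. int (m choose i) * (2 * v) ^ i * (int ((m - i) choose l) * (-3 * w) ^ l))"
  have ex: "(x ^ 3 - 3 * w * x + 2 * v) ^ m
      = (\<Sum>i\<le>m. \<Sum>l\<le>m - i. c i l * x ^ (3 * (m - i) - 2 * l))" for x
  proof -
    have "(x ^ 3 - 3 * w * x + 2 * v) ^ m = (2 * v + (- 3 * w * x + x ^ 3)) ^ m"
      by (simp add: algebra_simps)
    also have "\<dots> = (\<Sum>i\<le>m. int (m choose i) * (2 * v) ^ i * (- 3 * w * x + x ^ 3) ^ (m - i))"
      by (rule binomial_ring)
    also have "\<dots> = (\<Sum>i\<le>m. \<Sum>l\<le>m - i. c i l * x ^ (3 * (m - i) - 2 * l))"
    proof (rule sum.cong[OF refl])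
      fix i
      have "(- 3 * w * x + x ^ 3) ^ (m - i)
        = (\<Sum>l\<le>m - i. int ((m - i) choose l) * (- 3 * w * x) ^ l * (x ^ 3) ^ (m - i - l))"
        by (rule binomial_ring)
      also have "\<dots> = (\<Sum>l\<le>m - i. (int ((m - i) choose l) * (- 3 * w) ^ l) * x ^ (3 * (m - i) - 2 * l))"
      proof (rule sum.cong[OF refl])
        fix l assume "l \<in> {..m - i}"
        hence "3 * (m - i) - 2 * l = l + 3 * (m - i - l)" by auto
        thus "int ((m - i) choose l) * (- 3 * w * x) ^ l * (x ^ 3) ^ (m - i - l)
          = (int ((m - i) choose l) * (- 3 * w) ^ l) * x ^ (3 * (m - i) - 2 * l)"
          by (simp only: power_add power_mult power_mult_distrib mult_ac)
      qed
      finally show "int (m choose i) * (2 * v) ^ i * (- 3 * w * x + x ^ 3) ^ (m - i)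
        = (\<Sum>l\<le>m - i. c i l * x ^ (3 * (m - i) - 2 * l))"
        by (simp add: c_def sum_distrib_left mult_ac)
    qed
    finally show ?thesis .
  qed
  let ?S = "\<Sum>i\<le>m. \<Sum>l\<le>m - i. c i l * (if 3 * (m - i) - 2 * l = 2 * m then -1 else 0)"
  have "[(\<Sum>i\<le>m. \<Sum>l\<le>m - i. c i l * rsum (\<lambda>x. x ^ (3 * (m - i) - 2 * l))) = ?S] (mod int p)"
  proof (rule cong_sum, rule cong_sum, rule cong_scalar_left)
    fix i l
    have "3 * (m - i) - 2 * l \<le> 3 * (m - i)" by (rule diff_le_self)
    also have "\<dots> \<le> 3 * m" by (intro mult_le_mono2 diff_le_self)
    finally show "[rsum (\<lambda>x. x ^ (3 * (m - i) - 2 * l))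
      = (if 3 * (m - i) - 2 * l = 2 * m then -1 else 0)] (mod int p)"
      by (rule rsum_power_cong)
  qed
  moreover have "rsum (\<lambda>x. (x ^ 3 - 3 * w * x + 2 * v) ^ m)
      = (\<Sum>i\<le>m. \<Sum>l\<le>m - i. c i l * rsum (\<lambda>x. x ^ (3 * (m - i) - 2 * l)))"
    by (simp only: ex rsum_sum rsum_mult_left)
  moreover have "?S = (\<Sum>i\<le>m. \<Sum>l\<le>m - i. if 3 * i + 2 * l = m then - c i l else 0)"
  proof (rule sum.cong[OF refl], rule sum.cong[OF refl])
    fix i l assume "i \<in> {..m}" "l \<in> {..m - i}"
    moreover define r where "r = m - i"
    ultimately have r: "m = i + r" "l \<le> r" by simp_all
    have iff: "3 * (m - i) - 2 * l = 2 * m \<longleftrightarrow> 3 * i + 2 * l = m"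
      using r by linarith
    show "c i l * (if 3 * (m - i) - 2 * l = 2 * m then -1 else 0)
        = (if 3 * i + 2 * l = m then - c i l else 0)" unfolding iff by simp
  qed
  moreover have "(\<Sum>i\<le>m. \<Sum>l\<le>m - i. if 3 * i + 2 * l = m then - c i l else 0)
      = - (\<Sum>j\<le>m. rho m w j * v ^ (2 * j + m mod 2))"
    unfolding sum_weighted_pairs sum_negf[symmetric]
  proof (rule sum.cong[OF refl])
    fix j
    show "(let e = 2 * j + m mod 2 in if 3 * e \<le> m then - c e ((m - 3 * e) div 2) else 0)
      = - (rho m w j * v ^ (2 * j + m mod 2))"
      unfolding rho_def Let_def c_def by (simp add: power_mult_distrib)
  qed
  ultimately show ?thesis by (simp only:)
qed

text \<open>In the range 3 e \<le> m one has 2 l = m - 3 e, so 4 l = -(6 e + 1) modulo p. Then 4 (2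
  e + l + 1) = 2 e + 3 and 4 l - 8 = -3 (2 e + 3): both sides of \<open>rho_Suc\<close> share the
  factor 2 e + 3, which is smaller than p and cancels.\<close>

lemma rho_Suc_cong:
  assumes e: "e = 2 * j + m mod 2"
  shows "[36 * w ^ 3 * ((int e + 1) * (int e + 2)) * rho m w (Suc j)
    = (6 * int e + 1) * (6 * int e + 5) * rho m w j] (mod int p)"
proof (cases "3 * e \<le> m")
  case False
  hence "rho m w j = 0" "rho m w (Suc j) = 0" by (auto intro!: rho_eq_0 simp: e)
  thus ?thesis by simp
next
  case True
  then obtain l where l: "m = 3 * e + 2 * l" using rho_index[OF e] by blast
  let ?e = "int e" and ?l = "int l"
  have l4: "[4 * ?l = - (6 * ?e + 1)] (mod int p)"
    unfolding cong_iff_dvd_diff int_p_eq using l by (simp add: algebra_simps)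
  have "12 * (2 * ?e + 3) * (36 * w ^ 3 * ((?e + 1) * (?e + 2)) * rho m w (Suc j))
    = (rho m w (Suc j) * ((?e + 1) * (?e + 2) * (-27 * w ^ 3)) * -16) * (2 * ?e + 3)"
    by (simp add: algebra_simps)
  also have "[\<dots> = (rho m w (Suc j) * ((?e + 1) * (?e + 2) * (-27 * w ^ 3)) * -16) * (8 * ?e + 4 * ?l + 4)] (mod int p)"
  proof (rule cong_scalar_left)
    show "[2 * ?e + 3 = 8 * ?e + 4 * ?l + 4] (mod int p)"
      unfolding cong_iff_dvd_diff int_p_eq using l by (auto intro!: dvdI[of _ _ "-1"])
  qed
  also have "(rho m w (Suc j) * ((?e + 1) * (?e + 2) * (-27 * w ^ 3)) * -16) * (8 * ?e + 4 * ?l + 4)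
    = -64 * (rho m w (Suc j) * ((?e + 1) * (?e + 2) * (2 * ?e + ?l + 1)) * (-27 * w ^ 3))"
    by (simp add: algebra_simps)
  also have "\<dots> = -4 * ((4 * ?l) * (4 * ?l - 4) * (4 * ?l - 8)) * rho m w j"
    unfolding rho_Suc[OF e l] by (simp add: algebra_simps)
  also have "[\<dots> = -4 * ((- (6 * ?e + 1)) * (- (6 * ?e + 1) - 4) * (- (6 * ?e + 1) - 8)) * rho m w j] (mod int p)"
    by (intro cong_mult cong_diff cong_refl l4)
  also have "-4 * ((- (6 * ?e + 1)) * (- (6 * ?e + 1) - 4) * (- (6 * ?e + 1) - 8)) * rho m w j
    = 12 * (2 * ?e + 3) * ((6 * ?e + 1) * (6 * ?e + 5) * rho m w j)"
    by (simp add: algebra_simps)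
  finally have c: "[12 * (2 * ?e + 3) * (36 * w ^ 3 * ((?e + 1) * (?e + 2)) * rho m w (Suc j))
    = 12 * (2 * ?e + 3) * ((6 * ?e + 1) * (6 * ?e + 5) * rho m w j)] (mod int p)" .
  have "\<not> int p dvd 2 * ?e + 3"
    using l m_ge2 by (intro not_dvd_pos) (auto simp: int_p_eq)
  moreover have "\<not> int p dvd 12"
    using not_dvd_2 not_dvd_3 p_dvd_mult_iff[of 4 3] p_dvd_mult_iff[of 2 2] by simp
  ultimately have "\<not> int p dvd 12 * (2 * ?e + 3)" unfolding p_dvd_mult_iff by blast
  thus ?thesis using c by (rule cong_mult_cancel)
qed

end

section \<open>Legendre operators on integer polynomials\<close>

lemma coeff_numeral_mult: "coeff (numeral c * P) n = numeral c * coeff P n"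
  for P :: "'a :: comm_ring_1 poly"
  by (simp add: numeral_poly)

lemma pderiv_numeral_mult: "pderiv (numeral c * P) = numeral c * pderiv P"
  for P :: "'a :: idom poly"
  by (simp add: numeral_poly pderiv_smult)

lemma pcompose_numeral: "pcompose (numeral c) Q = (numeral c :: 'a :: comm_ring_1 poly)"
  by (simp add: numeral_poly)

lemma pderiv_pcompose_shift: "pderiv (pcompose P [:c, 1:]) = pcompose (pderiv P) [:c, 1:]"
  for P :: "'a :: idom poly"
  by (simp add: pderiv_pcompose pderiv_pCons)

text \<open>Congruence modulo p of integer polynomials is expressed below as divisibility by the
  constant \<open>[:int p:]\<close>; it survives translation and differentiation.\<close>

lemma const_dvd_pcompose:
  fixes c :: "'a :: comm_ring_1"
  assumes "[:c:] dvd P"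
  shows "[:c:] dvd pcompose P Q"
proof -
  obtain K where "P = [:c:] * K" using assms by (rule dvdE)
  hence "pcompose P Q = [:c:] * pcompose K Q" by (simp only: pcompose_mult pcompose_const)
  thus ?thesis by (rule dvdI)
qed

lemma const_dvd_pderiv:
  fixes c :: "'a :: idom"
  assumes "[:c:] dvd P"
  shows "[:c:] dvd pderiv P"
proof -
  obtain K where "P = [:c:] * K" using assms by (rule dvdE)
  hence "pderiv P = [:c:] * pderiv K" by (simp add: pderiv_smult)
  thus ?thesis by (rule dvdI)
qed

text \<open>Modulo \<open>p\<close> the Hasse invariant satisfies, as a function \<open>P\<close> of \<open>v\<close>, the Legendre equation
  \<open>36 ((v^2 - w^3) P')' + 5 P = 0\<close>. The next two operators are its left-hand side for \<open>P = R(v^2)\<close>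
  and, divided by \<open>v\<close>, for \<open>P = v R(v^2)\<close>, written in the variable \<open>s = v^2\<close> with \<open>q = s - w^3\<close>; the
  third one is the symmetric square of the equation, which annihilates \<open>P^2\<close>.\<close>

definition legendre_even :: "int poly \<Rightarrow> int poly \<Rightarrow> int poly \<Rightarrow> int poly" where
  "legendre_even s q R = 36 * (2 * q * pderiv R + 4 * s * pderiv (q * pderiv R)) + 5 * R"

definition legendre_odd :: "int poly \<Rightarrow> int poly \<Rightarrow> int poly \<Rightarrow> int poly" where
  "legendre_odd s q R = 72 * pderiv (q * R + 2 * s * q * pderiv R) + 5 * R"

definition legendre_symsquare :: "int poly \<Rightarrow> int poly \<Rightarrow> int poly \<Rightarrow> int poly" where
  "legendre_symsquare s q F =
     36 * pderiv (2 * q * q * pderiv F + 4 * q * s * pderiv (q * pderiv F)) + 10 * (2 * q * pderiv F + F)"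

text \<open>The right-hand side is a combination of the Legendre expression and its derivative, so
  it vanishes modulo p whenever that expression does. With \<open>s\<close> and \<open>q\<close>
  kept as letters of derivative 1, this is a formal identity in s, q, R and the derivatives of
  R.\<close>

lemma legendre_symsquare_even:
  assumes "pderiv s = 1" "pderiv q = 1"
  shows "legendre_symsquare s q (R * R)
    = 4 * q * pderiv R * legendre_even s q R + 2 * pderiv (q * R) * legendre_even s q R
      + 2 * q * R * pderiv (legendre_even s q R)"
  unfolding legendre_symsquare_def legendre_even_def
  by (simp add: pderiv_mult pderiv_add pderiv_numeral_mult assms algebra_simps)

lemma legendre_symsquare_odd:
  assumes "pderiv s = 1" "pderiv q = 1"
  shows "legendre_symsquare s q (s * (R * R))
    = 2 * q * (R + 2 * s * pderiv R) * legendre_odd s q R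
      + (q * R + 2 * s * pderiv (q * R)) * legendre_odd s q R
      + q * R * (legendre_odd s q R + 2 * s * pderiv (legendre_odd s q R))"
  unfolding legendre_symsquare_def legendre_odd_def
  by (simp add: pderiv_mult pderiv_add pderiv_numeral_mult assms algebra_simps)

lemma pcompose_legendre_symsquare:
  "pcompose (legendre_symsquare s q F) [:c, 1:]
    = legendre_symsquare (pcompose s [:c, 1:]) (pcompose q [:c, 1:]) (pcompose F [:c, 1:])"
  unfolding legendre_symsquare_def
  by (simp add: pcompose_mult pcompose_add pcompose_numeral pderiv_pcompose_shift[symmetric])

lemma coeff_linear_mult: "coeff ([:a, 1:] * P) n = a * coeff P n + (if n = 0 then 0 else coeff P (n - 1))"
  for P :: "'a :: comm_ring_1 poly"
  by (cases n) (simp_all add: coeff_pCons)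

text \<open>With e = 2 j, 36 e (e + 1) + 5 = (6 e + 1)(6 e + 5), so for c = w^3 and the coefficients
  \<open>rho\<close> the vanishing modulo p is \<open>rho_Suc_cong\<close>. The odd operator gives
  the same with e = 2 j + 1.\<close>

lemma coeff_legendre_even:
  "coeff (legendre_even [:0, 1:] [:-c, 1:] R) j
    = (36 * (2 * int j * (2 * int j + 1)) + 5) * coeff R j
      - 36 * c * ((2 * int j + 1) * (2 * int j + 2)) * coeff R (Suc j)"
  unfolding legendre_even_def
  by (cases j)
    (simp_all only: coeff_add coeff_numeral_mult coeff_pderiv coeff_linear_mult mult.assoc, simp_all add: algebra_simps)

lemma coeff_legendre_odd:
  "coeff (legendre_odd [:0, 1:] [:-c, 1:] R) j
    = (36 * ((2 * int j + 1) * (2 * int j + 2)) + 5) * coeff R j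
      - 36 * c * ((2 * int j + 2) * (2 * int j + 3)) * coeff R (Suc j)"
  unfolding legendre_odd_def
  by (cases j)
    (simp_all only: coeff_add coeff_numeral_mult coeff_pderiv coeff_linear_mult mult.assoc, simp_all add: algebra_simps)

text \<open>Translated to the singular point, q is the variable and s = q + c, so only two
  consecutive coefficients of F meet. Three times 2 k + 1 is the middle factor 6 k + 3 of
  \<open>mu_Suc_cong\<close>.\<close>

lemma coeff_legendre_symsquare:
  "coeff (legendre_symsquare [:c, 1:] [:0, 1:] F) k
    = 2 * (2 * int k + 1) * (6 * int k + 1) * (6 * int k + 5) * coeff F k
      + 144 * c * (int k + 1) ^ 3 * coeff F (Suc k)"
  unfolding legendre_symsquare_def
  by (cases k)
    (simp_all only: coeff_add coeff_numeral_mult coeff_pderiv coeff_linear_mult mult.assoc,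
     simp_all add: algebra_simps power3_eq_cube)

lemma poly_eq_sum_coeff:
  fixes P :: "'a :: comm_ring_1 poly"
  assumes "degree P \<le> n"
  shows "poly P x = (\<Sum>i\<le>n. coeff P i * x ^ i)"
  unfolding poly_altdef
  by (rule sum.mono_neutral_left) (use assms in \<open>auto simp: coeff_eq_0\<close>)

context prime_gt3 begin

definition hasse_poly :: "int \<Rightarrow> int poly" where
  "hasse_poly w = (\<Sum>j\<le>m. monom (rho m w j) j)"

text \<open>The Hasse invariant is, up to sign, R(v^2) or v R(v^2) according to the parity of m. In
  both cases its square is a polynomial in s = v^2; the factor \<open>[:0, 1:]\<close> is
  v^2.\<close>

definition hasse_square :: "int \<Rightarrow> int poly" where
  "hasse_square w = (if even m then hasse_poly w * hasse_poly w else [:0, 1:] * (hasse_poly w * hasse_poly w))"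

text \<open>At the singular point \<open>s = w^3\<close> all exponents vanish, so the Taylor coefficients there obey
  a two-term recurrence. It is the recurrence of the numbers \<open>mu m k / (27 w^3)^k\<close>.\<close>

definition hasse_taylor :: "int \<Rightarrow> int poly" where
  "hasse_taylor w = pcompose (hasse_square w) [:w ^ 3, 1:]"

lemma coeff_hasse_poly: "coeff (hasse_poly w) j = rho m w j"
proof -
  have "coeff (hasse_poly w) j = (if j \<le> m then rho m w j else 0)"
    by (simp add: hasse_poly_def coeff_sum if_distrib cong: if_cong)
  thus ?thesis by (simp add: rho_eq_0)
qed

lemma degree_hasse_poly: "degree (hasse_poly w) \<le> m div 6"
  by (rule degree_le) (auto simp: coeff_hasse_poly intro!: rho_eq_0)

text \<open>Keeps the Taylor sum at indices at most m < p, within the range of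
  \<open>hasse_taylor_cong\<close>.\<close>

lemma degree_hasse_taylor: "degree (hasse_taylor w) \<le> m"
proof -
  have "degree (hasse_poly w * hasse_poly w) \<le> m div 6 + m div 6"
    using degree_mult_le[of "hasse_poly w" "hasse_poly w"] degree_hasse_poly[of w] by linarith
  moreover have "degree ([:0, 1:] * (hasse_poly w * hasse_poly w)) \<le> 1 + degree (hasse_poly w * hasse_poly w)"
    using degree_mult_le[of "[:0, 1:]" "hasse_poly w * hasse_poly w"] by simp
  ultimately have "degree (hasse_square w) \<le> 1 + (m div 6 + m div 6)"
    by (simp add: hasse_square_def)
  also have "\<dots> \<le> m" using m_ge2 by presburger
  finally show ?thesis
    unfolding hasse_taylor_def using degree_pcompose_le[of "hasse_square w" "[:w ^ 3, 1:]"] by simp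
qed

lemma poly_hasse_square: "poly (hasse_square w) (v\<^sup>2) = (\<Sum>j\<le>m. rho m w j * v ^ (2 * j + m mod 2))\<^sup>2"
proof -
  have "(\<Sum>j\<le>m. rho m w j * v ^ (2 * j + m mod 2)) = v ^ (m mod 2) * poly (hasse_poly w) (v\<^sup>2)"
    unfolding hasse_poly_def poly_sum poly_monom sum_distrib_left
    by (intro sum.cong refl) (simp add: power_add power_mult)
  thus ?thesis
    by (cases "even m") (auto simp: hasse_square_def power2_eq_square odd_iff_mod_2_eq_one even_iff_mod_2_eq_zero mult_ac)
qed

lemma poly_hasse_taylor: "poly (hasse_taylor w) x = poly (hasse_square w) (w ^ 3 + x)"
  by (simp add: hasse_taylor_def poly_pcompose)

lemma p_dvd_legendre_symsquare_hasse_square: "[:int p:] dvd legendre_symsquare [:0, 1:] [:- (w ^ 3), 1:] (hasse_square w)"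
proof (cases "even m")
  case True
  have "[:int p:] dvd legendre_even [:0, 1:] [:- (w ^ 3), 1:] (hasse_poly w)"
    unfolding const_poly_dvd_iff coeff_legendre_even coeff_hasse_poly
  proof
    fix j
    have "[36 * w ^ 3 * ((int (2 * j) + 1) * (int (2 * j) + 2)) * rho m w (Suc j)
      = (6 * int (2 * j) + 1) * (6 * int (2 * j) + 5) * rho m w j] (mod int p)"
      by (rule rho_Suc_cong) (use True in simp)
    from cong_sym[OF this] show "int p dvd (36 * (2 * int j * (2 * int j + 1)) + 5) * rho m w j
        - 36 * w ^ 3 * ((2 * int j + 1) * (2 * int j + 2)) * rho m w (Suc j)"
      unfolding cong_iff_dvd_diff by (simp add: algebra_simps)
  qed
  thus ?thesis
    unfolding hasse_square_def if_P[OF True]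
    by (subst legendre_symsquare_even)
      (simp_all add: pderiv_pCons del: mult_pCons_left, intro dvd_add dvd_mult const_dvd_pderiv)
next
  case False
  hence modm: "m mod 2 = 1" by (simp add: odd_iff_mod_2_eq_one)
  have "[:int p:] dvd legendre_odd [:0, 1:] [:- (w ^ 3), 1:] (hasse_poly w)"
    unfolding const_poly_dvd_iff coeff_legendre_odd coeff_hasse_poly
  proof
    fix j
    have "[36 * w ^ 3 * ((int (2 * j + 1) + 1) * (int (2 * j + 1) + 2)) * rho m w (Suc j)
      = (6 * int (2 * j + 1) + 1) * (6 * int (2 * j + 1) + 5) * rho m w j] (mod int p)"
      by (rule rho_Suc_cong) (simp add: modm)
    from cong_sym[OF this] show "int p dvd (36 * ((2 * int j + 1) * (2 * int j + 2)) + 5) * rho m w j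
        - 36 * w ^ 3 * ((2 * int j + 2) * (2 * int j + 3)) * rho m w (Suc j)"
      unfolding cong_iff_dvd_diff by (simp add: algebra_simps)
  qed
  thus ?thesis
    unfolding hasse_square_def if_not_P[OF False]
    by (subst legendre_symsquare_odd)
      (simp_all add: pderiv_pCons del: mult_pCons_left, intro dvd_add dvd_mult const_dvd_pderiv)
qed

lemma hasse_taylor_Suc_cong:
  "[144 * w ^ 3 * (int k + 1) ^ 3 * coeff (hasse_taylor w) (Suc k)
    = - (2 * (2 * int k + 1) * (6 * int k + 1) * (6 * int k + 5) * coeff (hasse_taylor w) k)] (mod int p)"
proof -
  have "[:int p:] dvd pcompose (legendre_symsquare [:0, 1:] [:- (w ^ 3), 1:] (hasse_square w)) [:w ^ 3, 1:]"
    by (rule const_dvd_pcompose) (rule p_dvd_legendre_symsquare_hasse_square)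
  hence "[:int p:] dvd legendre_symsquare [:w ^ 3, 1:] [:0, 1:] (hasse_taylor w)"
    by (simp add: pcompose_legendre_symsquare hasse_taylor_def[symmetric] pcompose_pCons)
  hence "int p dvd coeff (legendre_symsquare [:w ^ 3, 1:] [:0, 1:] (hasse_taylor w)) k"
    by (simp only: const_poly_dvd_iff)
  thus ?thesis
    unfolding coeff_legendre_symsquare cong_iff_dvd_diff by (simp add: add.commute)
qed

text \<open>Clausen's identity modulo p, coefficientwise: after scaling by (27 w^3)^k both sides
  obey the same first-order recurrence, whose leading factor 144 (k + 1)^3 is a unit as long as k +
  1 < p.\<close>

lemma hasse_taylor_cong:
  "k < p \<Longrightarrow> [(27 * w ^ 3) ^ k * coeff (hasse_taylor w) k = coeff (hasse_taylor w) 0 * int (mu m k)] (mod int p)"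
proof (induction k)
  case 0
  thus ?case by (simp add: mu_def)
next
  case (Suc k)
  let ?k = "int k"
  have "[27 * (27 * w ^ 3) ^ k * (144 * w ^ 3 * (?k + 1) ^ 3 * coeff (hasse_taylor w) (Suc k))
    = 27 * (27 * w ^ 3) ^ k * - (2 * (2 * ?k + 1) * (6 * ?k + 1) * (6 * ?k + 5) * coeff (hasse_taylor w) k)] (mod int p)"
    by (rule cong_scalar_left[OF hasse_taylor_Suc_cong])
  hence 1: "[144 * (?k + 1) ^ 3 * ((27 * w ^ 3) ^ Suc k * coeff (hasse_taylor w) (Suc k))
    = - (54 * (2 * ?k + 1) * (6 * ?k + 1) * (6 * ?k + 5)) * ((27 * w ^ 3) ^ k * coeff (hasse_taylor w) k)] (mod int p)"
    by (simp add: algebra_simps)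
  have 2: "[- (54 * (2 * ?k + 1) * (6 * ?k + 1) * (6 * ?k + 5)) * ((27 * w ^ 3) ^ k * coeff (hasse_taylor w) k)
    = - (54 * (2 * ?k + 1) * (6 * ?k + 1) * (6 * ?k + 5)) * (coeff (hasse_taylor w) 0 * int (mu m k))] (mod int p)"
    by (rule cong_scalar_left) (use Suc in simp)
  \<comment> \<open>The factor 18 matches the two recurrences: 18 * 8 = 144 and 18 (6 k + 3) = 54 (2
    k + 1).\<close>
  have "[18 * coeff (hasse_taylor w) 0 * (8 * (?k + 1) ^ 3 * int (mu m (Suc k)))
    = 18 * coeff (hasse_taylor w) 0 * (- ((6 * ?k + 1) * (6 * ?k + 3) * (6 * ?k + 5)) * int (mu m k))] (mod int p)"
    by (rule cong_scalar_left[OF mu_Suc_cong])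
  hence 3: "[144 * (?k + 1) ^ 3 * (coeff (hasse_taylor w) 0 * int (mu m (Suc k)))
    = - (54 * (2 * ?k + 1) * (6 * ?k + 1) * (6 * ?k + 5)) * (coeff (hasse_taylor w) 0 * int (mu m k))] (mod int p)"
    by (simp add: algebra_simps)
  have c: "[144 * (?k + 1) ^ 3 * ((27 * w ^ 3) ^ Suc k * coeff (hasse_taylor w) (Suc k))
    = 144 * (?k + 1) ^ 3 * (coeff (hasse_taylor w) 0 * int (mu m (Suc k)))] (mod int p)"
    by (rule cong_trans[OF cong_trans[OF 1 2] cong_sym[OF 3]])
  have "\<not> int p dvd 144"
    using not_dvd_2 not_dvd_3 p_dvd_mult_iff[of 16 9] p_dvd_mult_iff[of 3 3] p_dvd_power_iff[of 4 2] by simp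
  moreover have "\<not> int p dvd ?k + 1"
    using not_dvd_small[of "Suc k"] Suc.prems by (simp add: add.commute)
  ultimately have "\<not> int p dvd 144 * (?k + 1) ^ 3"
    by (simp add: p_dvd_mult_iff p_dvd_power_iff)
  thus ?case using c by (rule cong_mult_cancel)
qed

text \<open>Give w weight 2 and v weight 3: every term of the Hasse invariant has weight 3 e + 2 l =
  m, so at v^2 = w^3 its square is w^m times the value at w = v = 1. Since v = w^(3/2) need not be
  an integer, a factor \<open>w ^ (m mod 2)\<close> keeps the exponents integral.\<close>

lemma hasse_taylor_0: "coeff (hasse_taylor w) 0 = w ^ m * (\<Sum>j\<le>m. rho m 1 j)\<^sup>2"
proof -
  have rho: "rho m w j * w ^ (3 * j + m mod 2) = rho m 1 j * w ^ (m div 2)" for j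
  proof (cases "3 * (2 * j + m mod 2) \<le> m")
    case True
    define e where "e = 2 * j + m mod 2"
    have "3 * e \<le> m" using True by (simp only: e_def)
    then obtain l where l: "m = 3 * e + 2 * l" using rho_index[OF e_def] by blast
    hence "(m - 3 * e) div 2 = l" by simp
    moreover have "l + (3 * j + m mod 2) = m div 2"
      using l e_def mult_div_mod_eq[of 2 m] by linarith
    ultimately have "(m - 3 * e) div 2 + (3 * j + m mod 2) = m div 2" by simp
    hence "w ^ ((m - 3 * e) div 2) * w ^ (3 * j + m mod 2) = w ^ (m div 2)"
      by (simp only: power_add[symmetric])
    hence "(-3 * w) ^ ((m - 3 * e) div 2) * w ^ (3 * j + m mod 2)
        = (-3 * 1) ^ ((m - 3 * e) div 2) * w ^ (m div 2)"
      by (simp only: power_mult_distrib mult.assoc mult_1 power_one)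
    thus ?thesis
      unfolding rho_def Let_def e_def[symmetric] if_P[OF \<open>3 * e \<le> m\<close>] by (simp only: mult.assoc)
  qed (simp add: rho_eq_0)
  have "poly (hasse_poly w) (w ^ 3) * w ^ (m mod 2) = (\<Sum>j\<le>m. rho m w j * w ^ (3 * j + m mod 2))"
    unfolding hasse_poly_def poly_sum poly_monom sum_distrib_right
    by (intro sum.cong refl) (simp add: power_add power_mult)
  also have "\<dots> = (\<Sum>j\<le>m. rho m 1 j) * w ^ (m div 2)"
    by (simp add: rho sum_distrib_right)
  finally have R: "poly (hasse_poly w) (w ^ 3) * w ^ (m mod 2) = (\<Sum>j\<le>m. rho m 1 j) * w ^ (m div 2)" .
  have "coeff (hasse_taylor w) 0 = poly (hasse_square w) (w ^ 3)"
    using poly_hasse_taylor[of w 0] by (simp add: poly_0_coeff_0)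
  also have "\<dots> = w ^ (m mod 2) * (poly (hasse_poly w) (w ^ 3) * w ^ (m mod 2))\<^sup>2"
    by (cases "even m") (auto simp: hasse_square_def power2_eq_square odd_iff_mod_2_eq_one even_iff_mod_2_eq_zero power3_eq_cube mult_ac)
  also have "\<dots> = w ^ (m mod 2 + 2 * (m div 2)) * (\<Sum>j\<le>m. rho m 1 j)\<^sup>2"
    unfolding R by (simp only: power_mult_distrib power_add power_even_eq mult_ac)
  finally show ?thesis by simp
qed

lemma rsum_chi_cubic_cong:
  "[rsum (\<lambda>x. chi (x ^ 3 - 3 * w * x + 2 * v)) = - (\<Sum>j\<le>m. rho m w j * v ^ (2 * j + m mod 2))] (mod int p)"
proof -
  have "[rsum (\<lambda>x. chi (x ^ 3 - 3 * w * x + 2 * v)) = rsum (\<lambda>x. (x ^ 3 - 3 * w * x + 2 * v) ^ m)] (mod int p)"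
    unfolding rsum_def by (rule cong_sum) (rule chi_euler)
  thus ?thesis using rsum_cubic_power by (rule cong_trans)
qed

text \<open>At the double root x = 1 the symbol is 0, elsewhere it is that of x + 2; the full sum of
  the latter vanishes, and the term missing from it is \<open>chi 3\<close>.\<close>

lemma rsum_singular_cubic: "rsum (\<lambda>x. chi (x ^ 3 - 3 * 1 * x + 2 * 1)) = - chi 3"
proof -
  have per: "periodic (\<lambda>x. chi (x ^ 3 - 3 * 1 * x + 2 * 1))"
    by (intro periodic_comp_chi cong_mult cong_add cong_diff cong_pow cong_refl)
  have "rsum (\<lambda>x. chi (x ^ 3 - 3 * 1 * x + 2 * 1)) = rsum (\<lambda>x. chi ((x + 1) ^ 3 - 3 * 1 * (x + 1) + 2 * 1))"
    by (rule rsum_shift[OF per, symmetric])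
  also have "\<dots> = rsum (\<lambda>x. chi (x + 3) + (if x = 0 then - chi 3 else 0))"
  proof (rule rsum_cong)
    fix x assume x: "x \<in> {0..<int p}"
    have "(x + 1) ^ 3 - 3 * 1 * (x + 1) + 2 * 1 = x\<^sup>2 * (x + 3)"
      by (simp add: power2_eq_square power3_eq_cube algebra_simps)
    thus "chi ((x + 1) ^ 3 - 3 * 1 * (x + 1) + 2 * 1) = chi (x + 3) + (if x = 0 then - chi 3 else 0)"
      using not_dvd_residue[OF x] by (auto simp: chi_mult chi_power2)
  qed
  also have "\<dots> = rsum (\<lambda>x. chi (x + 3)) - chi 3"
    using p_gt3 by (simp add: rsum_add) (simp add: rsum_def)
  also have "rsum (\<lambda>x. chi (x + 3)) = 0"
    using rsum_shift[of chi 3] periodic_comp_chi[of "\<lambda>x. x"] by (simp add: rsum_chi)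
  finally show ?thesis by simp
qed

text \<open>The constant of proportionality is read off from the singular cubic \<open>(x - 1)^2 (x + 2)\<close>.\<close>

lemma sum_rho_1_square: "[(\<Sum>j\<le>m. rho m 1 j)\<^sup>2 = 1] (mod int p)"
proof -
  have "[- chi 3 = - (\<Sum>j\<le>m. rho m 1 j)] (mod int p)"
    using rsum_chi_cubic_cong[of 1 1] by (simp add: rsum_singular_cubic[simplified])
  from cong_pow[OF cong_sym[OF this], of 2] show ?thesis
    using chi_square[OF not_dvd_3] by (simp add: power2_eq_square)
qed

text \<open>The Taylor polynomial at s = w^3 is evaluated at the increment v^2 - w^3 = 27 d, whose
  27 cancels against (27 w^3)^k. Multiplication by w^(3 m) clears the remaining powers of w and is
  undone at the end, as w is a unit.\<close>

lemma cubic_square_cong: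
  assumes w: "\<not> int p dvd w" and d: "v\<^sup>2 - w ^ 3 = 27 * d"
  shows "[(rsum (\<lambda>x. chi (x ^ 3 - 3 * w * x + 2 * v)))\<^sup>2
    = (\<Sum>k\<le>m div 3. int (mu m k) * d ^ k * w ^ (m - 3 * k))] (mod int p)"
proof -
  let ?B = "rsum (\<lambda>x. chi (x ^ 3 - 3 * w * x + 2 * v))"
  let ?c = "coeff (hasse_taylor w) 0"
  have "[?B\<^sup>2 = poly (hasse_square w) (v\<^sup>2)] (mod int p)"
    using cong_pow[OF rsum_chi_cubic_cong, of w v 2] by (simp add: poly_hasse_square)
  moreover have "poly (hasse_square w) (v\<^sup>2) = poly (hasse_taylor w) (27 * d)"
    unfolding poly_hasse_taylor d[symmetric] by simp
  moreover have "poly (hasse_taylor w) (27 * d) = (\<Sum>k\<le>m. coeff (hasse_taylor w) k * (27 * d) ^ k)"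
    by (rule poly_eq_sum_coeff[OF degree_hasse_taylor])
  ultimately have "[w ^ (3 * m) * ?B\<^sup>2 = w ^ (3 * m) * (\<Sum>k\<le>m. coeff (hasse_taylor w) k * (27 * d) ^ k)] (mod int p)"
    by (intro cong_scalar_left) simp
  also have "w ^ (3 * m) * (\<Sum>k\<le>m. coeff (hasse_taylor w) k * (27 * d) ^ k)
    = (\<Sum>k\<le>m. (27 * w ^ 3) ^ k * coeff (hasse_taylor w) k * (d ^ k * w ^ (3 * (m - k))))"
    unfolding sum_distrib_left
  proof (rule sum.cong[OF refl])
    fix k assume "k \<in> {..m}"
    hence "3 * m = 3 * k + 3 * (m - k)" by simp
    hence "w ^ (3 * m) = (w ^ 3) ^ k * w ^ (3 * (m - k))"
      by (simp only: power_mult[symmetric] power_add[symmetric])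
    thus "w ^ (3 * m) * (coeff (hasse_taylor w) k * (27 * d) ^ k)
      = (27 * w ^ 3) ^ k * coeff (hasse_taylor w) k * (d ^ k * w ^ (3 * (m - k)))"
      by (simp only: power_mult_distrib mult_ac)
  qed
  also have "[\<dots> = (\<Sum>k\<le>m. ?c * int (mu m k) * (d ^ k * w ^ (3 * (m - k))))] (mod int p)"
    by (intro cong_sum cong_scalar_right hasse_taylor_cong) (use p_eq in simp)
  also have "(\<Sum>k\<le>m. ?c * int (mu m k) * (d ^ k * w ^ (3 * (m - k))))
    = (\<Sum>k\<le>m div 3. ?c * int (mu m k) * (d ^ k * w ^ (3 * (m - k))))"
    by (rule sum.mono_neutral_right) (auto intro!: mu_eq_0)
  also have "\<dots> = w ^ (3 * m) * (\<Sum>j\<le>m. rho m 1 j)\<^sup>2 * (\<Sum>k\<le>m div 3. int (mu m k) * d ^ k * w ^ (m - 3 * k))"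
    unfolding sum_distrib_left hasse_taylor_0
  proof (rule sum.cong[OF refl])
    fix k assume "k \<in> {..m div 3}"
    hence "3 * k \<le> m" by auto
    hence "m + 3 * (m - k) = 3 * m + (m - 3 * k)" by linarith
    hence "w ^ m * w ^ (3 * (m - k)) = w ^ (3 * m) * w ^ (m - 3 * k)"
      by (simp only: power_add[symmetric])
    hence "(w ^ m * w ^ (3 * (m - k))) * ((\<Sum>j\<le>m. rho m 1 j)\<^sup>2 * int (mu m k) * d ^ k)
      = (w ^ (3 * m) * w ^ (m - 3 * k)) * ((\<Sum>j\<le>m. rho m 1 j)\<^sup>2 * int (mu m k) * d ^ k)"
      by (rule arg_cong)
    thus "w ^ m * (\<Sum>j\<le>m. rho m 1 j)\<^sup>2 * int (mu m k) * (d ^ k * w ^ (3 * (m - k)))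
      = w ^ (3 * m) * (\<Sum>j\<le>m. rho m 1 j)\<^sup>2 * (int (mu m k) * d ^ k * w ^ (m - 3 * k))"
      by (simp only: mult_ac)
  qed
  also have "[\<dots> = w ^ (3 * m) * 1 * (\<Sum>k\<le>m div 3. int (mu m k) * d ^ k * w ^ (m - 3 * k))] (mod int p)"
    by (intro cong_mult cong_refl sum_rho_1_square)
  finally have c: "[w ^ (3 * m) * ?B\<^sup>2
    = w ^ (3 * m) * (\<Sum>k\<le>m div 3. int (mu m k) * d ^ k * w ^ (m - 3 * k))] (mod int p)" by simp
  have "\<not> int p dvd w ^ (3 * m)" using w m_ge2 by (simp add: p_dvd_power_iff)
  thus ?thesis using c by (rule cong_mult_cancel)
qed

end

section \<open>Congruences between rationals, and the conclusion\<close>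

text \<open>The reduced denominator divides every denominator d of r, by coprimality.\<close>

lemma p_integralI:
  assumes "r * of_int d = of_int a" "\<not> int q dvd d"
  shows "r \<in> p_integral q"
proof -
  obtain x y where xy: "quotient_of r = (x, y)" by (cases "quotient_of r")
  have y: "y > 0" "coprime x y" "r = of_int x / of_int y"
    using quotient_of_denom_pos[OF xy] quotient_of_coprime[OF xy] quotient_of_div[OF xy] .
  have "of_int (x * d) = (of_int (a * y) :: rat)"
    using assms(1) y by (simp add: field_simps)
  hence "x * d = a * y" by (simp only: of_int_eq_iff)
  hence "y dvd x * d" by simp
  hence "y dvd d" using y(2) by (simp add: coprime_dvd_mult_right_iff coprime_commute)
  thus ?thesis using assms(2) dvd_trans by (auto simp: p_integral_def xy)
qed

lemma rat_cong_of_int: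
  assumes "r * of_int d = of_int a" "\<not> int q dvd d" "[a = d * b] (mod int q)"
  shows "rat_cong r (of_int b) q"
proof -
  have d: "of_int d \<noteq> (0 :: rat)" using assms(2) by auto
  obtain c where c: "a - d * b = int q * c"
    using assms(3) unfolding cong_iff_dvd_diff by (rule dvdE)
  have one: "\<not> int q dvd 1" using assms(2) dvd_trans[of "int q" 1 d] by auto
  have "(r - of_int b) * of_int d = of_int (a - d * b)"
    using assms(1) by (simp add: algebra_simps)
  also have "\<dots> = of_nat q * of_int c" unfolding c by simp
  finally have "r - of_int b = of_nat q * (of_int c / of_int d)"
    using d by (simp add: field_simps)
  moreover have "of_int c / of_int d \<in> p_integral q"
    by (rule p_integralI[OF _ assms(2)]) (use d in simp)
  moreover have "r \<in> p_integral q" by (rule p_integralI[OF assms(1,2)])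
  moreover have "of_int b \<in> p_integral q" by (rule p_integralI[OF _ one]) simp
  ultimately show ?thesis unfolding rat_cong_def by blast
qed

context prime_gt3 begin

lemma p_eq_11: "int p dvd 11 \<Longrightarrow> p = 11"
proof -
  assume "int p dvd 11"
  hence "int p dvd int 11" by simp
  hence "p dvd 11" by (simp only: int_dvd_int_iff)
  moreover have "prime (11 :: nat)" by (simp add: prime_nat_numeral_eq)
  ultimately show ?thesis using prime_p primes_dvd_imp_eq by blast
qed

text \<open>The Taylor expansion needs \<open>p\<close> not to divide \<open>w = 33\<close>, so \<open>p = 11\<close> is separate.\<close>

lemma hsum_cong: "[hsum = (J (-1))\<^sup>2] (mod int p)"
proof (cases "p = 11")
  case True
  hence m: "m = 5" using p_eq by simp
  hence "J (-1) = 0" by (intro J_odd) simp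
  moreover have "int p dvd hsum"
    unfolding hsum_def
  proof (rule dvd_sum)
    fix k assume "k \<in> {..m div 3}"
    hence "k \<le> 1" using m by simp
    hence "m - 3 * k > 0" using m by simp
    hence "(33 :: int) dvd 33 ^ (m - 3 * k)" by (rule dvd_power[OF disjI1])
    moreover have "int p dvd 33" using True by simp
    ultimately have "int p dvd 33 ^ (m - 3 * k)" by (rule dvd_trans[rotated])
    thus "int p dvd int (mu m k) * (-8) ^ k * 33 ^ (m - 3 * k)" by (rule dvd_mult)
  qed
  ultimately show ?thesis by (simp add: cong_0_iff)
next
  case False
  have "\<not> int p dvd 33"
    using False p_eq_11 not_dvd_3 p_dvd_mult_iff[of 3 11] by auto
  hence "[(rsum (\<lambda>x. chi (x ^ 3 - 3 * 33 * x + 2 * 189)))\<^sup>2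
    = (\<Sum>k\<le>m div 3. int (mu m k) * (-8) ^ k * 33 ^ (m - 3 * k))] (mod int p)"
    by (rule cubic_square_cong) simp
  thus ?thesis unfolding rsum_cubic hsum_def[symmetric] by (rule cong_sym)
qed

text \<open>Modulo p, \<open>27 ^ m\<close> is the sign \<open>chi 3\<close>, which is its own
  inverse.\<close>

lemma sum_W_cong_J:
  assumes "[54 * g = 1] (mod int p)"
  shows "[(\<Sum>n<p. int ((2 * n) choose n) * W n * g ^ n) = chi 3 * (J (-1))\<^sup>2] (mod int p)"
proof -
  let ?T = "\<Sum>n<p. int ((2 * n) choose n) * W n * g ^ n"
  have "chi 27 = chi (3\<^sup>2 * 3)" by simp
  also have "\<dots> = chi 3" using not_dvd_3 by (simp only: chi_mult[of "3\<^sup>2"] chi_power2) simp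
  finally have "[27 ^ m = chi 3] (mod int p)" using chi_euler[of 27] by (simp add: cong_sym_eq)
  hence "[chi 3 * (27 ^ m * ?T) = chi 3 * (chi 3 * ?T)] (mod int p)"
    by (intro cong_mult cong_refl)
  also have "chi 3 * (chi 3 * ?T) = ?T" using chi_square[OF not_dvd_3] by (simp add: mult.assoc[symmetric])
  finally have "[?T = chi 3 * (27 ^ m * ?T)] (mod int p)" by (rule cong_sym)
  moreover have "[chi 3 * (27 ^ m * ?T) = chi 3 * (J (-1))\<^sup>2] (mod int p)"
    by (intro cong_scalar_left cong_trans[OF sum_W_cong[OF assms] hsum_cong])
  ultimately show ?thesis by (rule cong_trans)
qed

lemma rat_cong_sum_W:
  assumes "[chi 3 * (J (-1))\<^sup>2 = b] (mod int p)"
  shows "rat_cong (\<Sum>k=0..p-1. of_nat ((2 * k) choose k) * of_int (W k) / 54 ^ k) (of_int b) p"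
proof -
  let ?c = "\<lambda>k. int ((2 * k) choose k) * W k"
  have n54: "\<not> int p dvd 54"
    using not_dvd_2 not_dvd_3 p_dvd_mult_iff[of 2 27] p_dvd_power_iff[of 3 3] by simp
  then obtain g where g: "[54 * g = 1] (mod int p)" using inverse_exists by blast
  have set: "{0..p-1} = {..<p}" using p_gt3 by auto
  \<comment> \<open>\<open>54 ^ p\<close> is a common denominator of all terms and a unit modulo p;
    \<open>a\<close> is the resulting numerator, evaluated with the integer g that inverts
    54.\<close>
  define a where "a = (\<Sum>k<p. ?c k * 54 ^ (p - k))"
  have "(\<Sum>k=0..p-1. of_nat ((2 * k) choose k) * of_int (W k) / 54 ^ k) * of_int (54 ^ p)
      = (of_int a :: rat)"
    unfolding set a_def sum_distrib_right of_int_sum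
  proof (rule sum.cong[OF refl])
    fix k assume "k \<in> {..<p}"
    hence "p = k + (p - k)" by simp
    hence "(54 :: rat) ^ p = 54 ^ k * 54 ^ (p - k)" by (simp only: power_add[symmetric])
    thus "of_nat ((2 * k) choose k) * of_int (W k) / 54 ^ k * of_int (54 ^ p)
      = (of_int (?c k * 54 ^ (p - k)) :: rat)" by simp
  qed
  moreover have "\<not> int p dvd 54 ^ p" using n54 p_gt3 by (simp add: p_dvd_power_iff)
  moreover have "[a = 54 ^ p * b] (mod int p)"
  proof -
    have "[a = (\<Sum>k<p. ?c k * (54 ^ p * g ^ k))] (mod int p)"
      unfolding a_def
    proof (rule cong_sum, rule cong_scalar_left)
      fix k assume "k \<in> {..<p}"
      hence "p = (p - k) + k" by simp
      hence e: "(54 :: int) ^ p = 54 ^ (p - k) * 54 ^ k" by (simp only: power_add[symmetric])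
      have "[54 ^ (p - k) * (54 * g) ^ k = 54 ^ (p - k) * 1 ^ k] (mod int p)"
        by (intro cong_scalar_left cong_pow g)
      thus "[54 ^ (p - k) = 54 ^ p * g ^ k] (mod int p)"
        unfolding e by (simp add: power_mult_distrib mult.assoc cong_sym_eq)
    qed
    also have "(\<Sum>k<p. ?c k * (54 ^ p * g ^ k)) = 54 ^ p * (\<Sum>k<p. ?c k * g ^ k)"
      by (simp add: sum_distrib_left mult_ac)
    also have "[54 ^ p * (\<Sum>k<p. ?c k * g ^ k) = 54 ^ p * b] (mod int p)"
      by (intro cong_scalar_left cong_trans[OF sum_W_cong_J[OF g] assms])
    finally show ?thesis .
  qed
  ultimately show ?thesis by (rule rat_cong_of_int)
qed

text \<open>The sign in quadratic reciprocity is (-1)^(m * 1), which is 1 for even m, that is for p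
  = 1 modulo 4, the only case where the symbol enters the stated value.\<close>

lemma Legendre_3: assumes "even m" shows "Legendre (int p) 3 = chi 3"
proof -
  have "Legendre (int p) (int 3) * Legendre (int 3) (int p)
      = (-1) ^ ((p - 1) div 2 * ((3 - 1) div 2))"
    using prime_p p_gt3 by (intro Quadratic_Reciprocity) simp_all
  hence "Legendre (int p) 3 * chi 3 = 1"
    unfolding m_def[symmetric] using assms by (simp add: chi_def)
  thus ?thesis using chi_square[OF not_dvd_3] chi_range[of 3] by auto
qed

end

theorem theorem2p3:
  fixes p :: nat
  assumes "prime p" and "p > 3"
  defines "S \<equiv> (\<Sum>k=0..p-1. of_nat ((2 * k) choose k) * of_int (W k) / 54 ^ k :: rat)"
  shows "([p = 1] (mod 4) \<longrightarrow>
            (\<exists>x y :: int. int p = x^2 + 4 * y^2) \<and>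
            (\<forall>x y :: int. int p = x^2 + 4 * y^2 \<longrightarrow>
               rat_cong S (of_int (Legendre (int p) 3 * (4 * x^2 - 2 * int p))) p)) \<and>
         ([p = 3] (mod 4) \<longrightarrow> rat_cong S 0 p)"
proof -
  interpret prime_gt3 p using assms by unfold_locales
  show ?thesis
  proof (intro conjI impI)
    assume "[p = 1] (mod 4)"
    hence m: "even m" unfolding cong_def using p_eq by presburger
    show "\<exists>x y :: int. int p = x^2 + 4 * y^2" by (rule J_square(1)[OF m])
    show "\<forall>x y :: int. int p = x^2 + 4 * y^2 \<longrightarrow>
      rat_cong S (of_int (Legendre (int p) 3 * (4 * x^2 - 2 * int p))) p"
    proof (intro allI impI)
      fix x y :: int assume xy: "int p = x^2 + 4 * y^2"
      have "[chi 3 * (J (-1))\<^sup>2 = Legendre (int p) 3 * (4 * x^2 - 2 * int p)] (mod int p)"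
        unfolding Legendre_3[OF m] J_square(2)[OF m xy]
        by (rule cong_scalar_left) (simp add: cong_iff_dvd_diff)
      thus "rat_cong S (of_int (Legendre (int p) 3 * (4 * x^2 - 2 * int p))) p"
        unfolding S_def by (rule rat_cong_sum_W)
    qed
  next
    assume "[p = 3] (mod 4)"
    hence "odd m" unfolding cong_def using p_eq by presburger
    hence "[chi 3 * (J (-1))\<^sup>2 = 0] (mod int p)" by (simp add: J_odd)
    from rat_cong_sum_W[OF this] show "rat_cong S 0 p" unfolding S_def by simp
  qed
qed

end
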